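(* Let $y>\pi/2$, let $\rho=\mu^{-1}(y)$, and define the sequence $(x_n)_{n\ge 0}$ by Newton's iteration $$x_0=\frac1{\cosh y},\qquad x_{n+1}=x_n-\frac{\mu(x_n)-y}{\mu'(x_n)}\quad(n\ge 0).$$ Then every iterate is well defined and belongs to $(0,1)$, and $$x_n\longrightarrow\rho .$$ More precisely, let $a\in(1/2,1/\sqrt2)$ be the unique point such that $\mu''(r)>0$ for $0<r<a$ and $\mu''(r)<0$ for $a<r<1$. Then the following alternatives hold. (1) If $\rho\le a$, then $0<x_0<x_1<\cdots<x_n<\rho$ for every $n$. (2) If $\rho>a$, then the orbit $(x_n)$ reaches $[a,1)$ after finitely many steps, crosses to the right of $\rho$ at most once, and thereafter decreases strictly to $\rho$. In either case the convergence is eventually quadratic.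
   Context: For $0<r<1$ let $r'=\sqrt{1-r^2}$ and let $$\mathbf K(r)=\int_0^{\pi/2}\frac{dt}{\sqrt{1-r^2\sin^2 t}}$$ be Legendre's complete elliptic integral of the first kind. The Grötzsch modulus function is $$\mu(r)=\frac{\pi}{2}\,\frac{\mathbf K(r')}{\mathbf K(r)},\qquad 0<r<1.$$ It is a smooth, strictly decreasing homeomorphism from $(0,1)$ onto $(0,\infty)$, and $\mu^{-1}:(0,\infty)\to(0,1)$ denotes its inverse. Its derivative is $\mu'(r)=-\dfrac{\pi^2}{4r(1-r^2)\mathbf K(r)^2}<0$. The point $a$ with the stated sign pattern of $\mu''$ exists and is unique (it is the unique inflection point of $\mu$).
   Formalization: In case (2), strict decrease to ρ is asserted after the crossing if one occurs; if the orbit never crosses ρ, it is stated to be eventually equal to ρ, since for some y an iterate lands exactly on ρ and the orbit is then constant. *)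

theory Defs
  imports "HOL-Analysis.Analysis"
begin

definition elliptic_K :: "real \<Rightarrow> real" where
  "elliptic_K r = integral {0..pi/2} (\<lambda>t. 1 / sqrt (1 - r\<^sup>2 * (sin t)\<^sup>2))"

(* Like elliptic_K, a total function that is meaningful only for 0 < r < 1. *)
definition grotzsch_mu :: "real \<Rightarrow> real" where
  "grotzsch_mu r = pi / 2 * (elliptic_K (sqrt (1 - r\<^sup>2)) / elliptic_K r)"

definition grotzsch_mu_inv :: "real \<Rightarrow> real" where
  "grotzsch_mu_inv = the_inv_into {0<..<1} grotzsch_mu"

definition mu_inflection :: "real \<Rightarrow> bool" where
  "mu_inflection a \<longleftrightarrow> 0 < a \<and> a < 1 \<and>
     (\<forall>r. 0 < r \<and> r < a \<longrightarrow> deriv (deriv grotzsch_mu) r > 0) \<and>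
     (\<forall>r. a < r \<and> r < 1 \<longrightarrow> deriv (deriv grotzsch_mu) r < 0)"

definition crosses_right :: "(nat \<Rightarrow> real) \<Rightarrow> real \<Rightarrow> nat \<Rightarrow> bool" where
  "crosses_right x \<rho> m \<longleftrightarrow> x m \<le> \<rho> \<and> \<rho> < x (Suc m)"

end

theory Submission
  imports Defs
begin

text \<open>
  Newton's iteration for a decreasing function \<open>g\<close> with root \<open>p\<close> satisfies, by the mean value theorem,
  \<open>x\<^sub>n\<^sub>+\<^sub>1 - p = (x\<^sub>n - p) * (1 - g' z / g' x\<^sub>n)\<close> for some \<open>z\<close> strictly between \<open>x\<^sub>n\<close> and \<open>p\<close>
  (\<open>newton_step_error\<close>). For \<open>g = \<mu>\<close> and \<open>p = \<rho>\<close> everything is read off from the quotient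
  \<open>q = g' z / g' x\<^sub>n > 0\<close>. If \<open>p\<close> is at most the inflection point \<open>a\<close>, then \<open>\<mu>\<close> is convex up to \<open>p\<close> and
  \<open>q < 1\<close> for iterates left of \<open>p\<close>, so they increase and stay left of \<open>p\<close>. If \<open>a < p\<close>, then \<open>\<mu>\<close> is concave on
  \<open>[a, 1)\<close>. There \<open>q > 1\<close> for iterates left of \<open>p\<close>, so the next one lies
  beyond \<open>p\<close>, while \<open>q < 1\<close> for iterates right of \<open>p\<close>, so they decrease towards \<open>p\<close>. The only real danger
  is that an iterate left of \<open>p\<close> is thrown out of \<open>(0, 1)\<close>. It is not, because \<open>q \<le> 4/3\<close> as long as
  \<open>p \<le> 1 / \<surd>2\<close> (\<open>deriv_mu_ratio_bound\<close>): the overshoot is then at most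
  \<open>(p - x\<^sub>n) / 3 < p / 3\<close>, and \<open>4/3 * 1/\<surd>2 < 1\<close>. The limit of a monotone orbit is a zero of the Newton
  correction, hence \<open>p\<close>, and the error formula together with a bound of \<open>g''\<close> near \<open>p\<close> gives quadratic
  convergence.

  The properties of \<open>\<mu>\<close> come from the complete integrals \<open>K\<close> and \<open>E\<close>, which are taken here as functions
  of the parameter \<open>m = r\<^sup>2\<close>. Their derivatives are combinations of \<open>K\<close> and \<open>E\<close>; with Legendre's relation
  \<open>E K' + E' K - K K' = \<pi>/2\<close>, in which the prime denotes the value at \<open>1 - m\<close>,
  this yields the closed form of \<open>\<mu>'\<close>, and differentiating once more shows that
  \<open>\<mu>''\<close> has the sign of \<open>2 E / K - (1 + m)\<close>, a strictly decreasing function. Two elementary bounds do the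
  rest. The bound \<open>(1 - m) K \<le> E\<close> makes this function positive at \<open>r = 1/2\<close>. The bound
  \<open>2 E < (2 - m) K\<close> makes it negative at \<open>r = 1 / \<surd>2\<close>, which places \<open>a\<close> in between, and it also makes
  \<open>(1 - m) K\<^sup>4\<close> decreasing, hence less than \<open>(\<pi>/2)\<^sup>4\<close>. The latter means precisely that \<open>\<mu> (1 / cosh t) - t\<close>
  increases with \<open>t\<close>. As \<open>\<mu>\<close> is positive, so is this difference, and the
  starting point \<open>1 / cosh y\<close> lies to the left of \<open>\<rho>\<close>.
\<close>

section \<open>Complete elliptic integrals in the parameter\<close>

definition ellK :: "real \<Rightarrow> real" where
  "ellK m = integral {0..pi/2} (\<lambda>t. 1 / sqrt (1 - m * (sin t)\<^sup>2))"

definition ellE :: "real \<Rightarrow> real" where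
  "ellE m = integral {0..pi/2} (\<lambda>t. sqrt (1 - m * (sin t)\<^sup>2))"

text \<open>The derivative of \<open>ellK\<close> involves the third inverse power of
  \<open>\<Delta> = sqrt (1 - m * (sin t)\<^sup>2)\<close>; its integral is the complete integral of the third kind
  with characteristic equal to \<open>m\<close>, and it reduces to \<open>ellE\<close>.\<close>

definition ellJ :: "real \<Rightarrow> real" where
  "ellJ m = integral {0..pi/2} (\<lambda>t. 1 / sqrt (1 - m * (sin t)\<^sup>2) ^ 3)"

lemma modulus_pos:
  fixes m t :: real
  assumes "m < 1"
  shows "0 < 1 - m * (sin t)\<^sup>2"
proof (cases "m \<le> 0")
  case True
  then have "m * (sin t)\<^sup>2 \<le> 0" by (simp add: mult_nonpos_nonneg)
  then show ?thesis by linarith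
next
  case False
  have "(sin t)\<^sup>2 \<le> 1" by (simp add: abs_square_le_1)
  then have "m * (sin t)\<^sup>2 \<le> m * 1" using False by (intro mult_left_mono) auto
  then show ?thesis using assms by linarith
qed

lemma sqrt_modulus_nonzero:
  fixes m t :: real
  assumes "m < 1"
  shows "sqrt (1 - m * (sin t)\<^sup>2) \<noteq> 0"
  using modulus_pos[OF assms, of t] by simp

lemma ell_integrands_continuous:
  assumes "m < 1"
  shows "continuous_on A (\<lambda>t. 1 / sqrt (1 - m * (sin t)\<^sup>2))"
    and "continuous_on A (\<lambda>t. sqrt (1 - m * (sin t)\<^sup>2))"
    and "continuous_on A (\<lambda>t. 1 / sqrt (1 - m * (sin t)\<^sup>2) ^ 3)"
  by (intro continuous_intros ballI power_not_zero sqrt_modulus_nonzero assms)+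

lemma ell_integrable:
  assumes "m < 1"
  shows "(\<lambda>t. 1 / sqrt (1 - m * (sin t)\<^sup>2)) integrable_on {0..pi/2}"
    and "(\<lambda>t. sqrt (1 - m * (sin t)\<^sup>2)) integrable_on {0..pi/2}"
    and "(\<lambda>t. 1 / sqrt (1 - m * (sin t)\<^sup>2) ^ 3) integrable_on {0..pi/2}"
  using ell_integrands_continuous[OF assms] by (auto intro: integrable_continuous_real)

lemma ellK_has_derivative_integral:
  assumes "m < 1"
  shows "(ellK has_real_derivative
     integral {0..pi/2} (\<lambda>t. (sin t)\<^sup>2 / (2 * sqrt (1 - m * (sin t)\<^sup>2) ^ 3))) (at m)"
proof -
  have "((\<lambda>m. integral (cbox 0 (pi/2)) (\<lambda>t. 1 / sqrt (1 - m * (sin t)\<^sup>2))) has_field_derivative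
     integral (cbox 0 (pi/2)) (\<lambda>t. (sin t)\<^sup>2 / (2 * sqrt (1 - m * (sin t)\<^sup>2) ^ 3))) (at m within {..<1})"
  proof (rule leibniz_rule_field_derivative)
    fix k t :: real assume k: "k \<in> {..<1}"
    then have D: "0 < 1 - k * (sin t)\<^sup>2" by (intro modulus_pos) auto
    define d where "d = sqrt (1 - k * (sin t)\<^sup>2)"
    have d: "d > 0" using D by (simp add: d_def)
    have 1: "((\<lambda>k. sqrt (1 - k * (sin t)\<^sup>2)) has_field_derivative - (sin t)\<^sup>2 / (2 * d))
        (at k within {..<1})"
      unfolding d_def using D by (auto intro!: derivative_eq_intros simp: divide_simps)
    have "((\<lambda>k. 1 / sqrt (1 - k * (sin t)\<^sup>2)) has_field_derivative
        (0 * d - 1 * (- (sin t)\<^sup>2 / (2 * d))) / (d * d)) (at k within {..<1})"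
      unfolding d_def
      by (intro DERIV_divide DERIV_const 1[unfolded d_def]) (use d in \<open>simp add: d_def\<close>)
    also have "(0 * d - 1 * (- (sin t)\<^sup>2 / (2 * d))) / (d * d) = (sin t)\<^sup>2 / (2 * d ^ 3)"
      using d by (simp add: power3_eq_cube)
    finally show "((\<lambda>k. 1 / sqrt (1 - k * (sin t)\<^sup>2)) has_field_derivative
        (sin t)\<^sup>2 / (2 * sqrt (1 - k * (sin t)\<^sup>2) ^ 3)) (at k within {..<1})"
      unfolding d_def .
  next
    show "continuous_on ({..<1} \<times> cbox 0 (pi / 2))
      (\<lambda>(k, t). (sin t)\<^sup>2 / (2 * sqrt (1 - k * (sin t)\<^sup>2) ^ 3))"
      unfolding split_def
      by (intro continuous_intros ballI power_not_zero no_zero_divisors sqrt_modulus_nonzero) auto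
  qed (use assms ell_integrable(1) in auto)
  moreover have "at m within {..<1} = at m" using assms by (intro at_within_open) auto
  ultimately show ?thesis unfolding ellK_def[abs_def] by simp
qed

lemma ellE_has_derivative_integral:
  assumes "m < 1"
  shows "(ellE has_real_derivative
     integral {0..pi/2} (\<lambda>t. - (sin t)\<^sup>2 / (2 * sqrt (1 - m * (sin t)\<^sup>2)))) (at m)"
proof -
  have "((\<lambda>m. integral (cbox 0 (pi/2)) (\<lambda>t. sqrt (1 - m * (sin t)\<^sup>2))) has_field_derivative
     integral (cbox 0 (pi/2)) (\<lambda>t. - (sin t)\<^sup>2 / (2 * sqrt (1 - m * (sin t)\<^sup>2)))) (at m within {..<1})"
  proof (rule leibniz_rule_field_derivative)
    fix k t :: real assume k: "k \<in> {..<1}"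
    then have D: "0 < 1 - k * (sin t)\<^sup>2" by (intro modulus_pos) auto
    show "((\<lambda>k. sqrt (1 - k * (sin t)\<^sup>2)) has_field_derivative
        - (sin t)\<^sup>2 / (2 * sqrt (1 - k * (sin t)\<^sup>2))) (at k within {..<1})"
      using D by (auto intro!: derivative_eq_intros simp: divide_simps)
  next
    show "continuous_on ({..<1} \<times> cbox 0 (pi / 2))
      (\<lambda>(k, t). - (sin t)\<^sup>2 / (2 * sqrt (1 - k * (sin t)\<^sup>2)))"
      unfolding split_def
      by (intro continuous_intros ballI power_not_zero no_zero_divisors sqrt_modulus_nonzero) auto
  qed (use assms ell_integrable(2) in auto)
  moreover have "at m within {..<1} = at m" using assms by (intro at_within_open) auto
  ultimately show ?thesis unfolding ellE_def[abs_def] by simp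
qed

text \<open>Pointwise, \<open>\<Delta> - 1/\<Delta> = - m * (sin t)\<^sup>2 / \<Delta>\<close>.\<close>

lemma ellE_deriv:
  assumes "m < 1" "m \<noteq> 0"
  shows "(ellE has_real_derivative (ellE m - ellK m) / (2 * m)) (at m)"
proof -
  have "integral {0..pi/2} (\<lambda>t. - (sin t)\<^sup>2 / (2 * sqrt (1 - m * (sin t)\<^sup>2)))
      = integral {0..pi/2} (\<lambda>t. (sqrt (1 - m * (sin t)\<^sup>2) - 1 / sqrt (1 - m * (sin t)\<^sup>2)) / (2 * m))"
  proof (rule integral_cong)
    fix t :: real
    have D: "0 < 1 - m * (sin t)\<^sup>2" using assms by (intro modulus_pos) auto
    then have "sqrt (1 - m * (sin t)\<^sup>2) * sqrt (1 - m * (sin t)\<^sup>2) = 1 - m * (sin t)\<^sup>2" by simp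
    with D assms show "- (sin t)\<^sup>2 / (2 * sqrt (1 - m * (sin t)\<^sup>2))
       = (sqrt (1 - m * (sin t)\<^sup>2) - 1 / sqrt (1 - m * (sin t)\<^sup>2)) / (2 * m)"
      by (simp add: field_simps)
  qed
  also have "\<dots> = (ellE m - ellK m) / (2 * m)"
    using ell_integrable[OF assms(1)] unfolding ellE_def ellK_def
    by (subst integral_divide, subst integral_diff) auto
  finally show ?thesis using ellE_has_derivative_integral[OF assms(1)] by simp
qed

text \<open>The single antiderivative behind all reductions of elliptic integrals below: \<open>sin t * cos t / \<Delta>\<close>
  vanishes at both ends of \<open>[0, \<pi>/2]\<close>, so its derivative integrates to zero.\<close>

lemma sin_cos_over_Delta_deriv:
  fixes m t :: real
  assumes "m < 1"
  defines "d \<equiv> sqrt (1 - m * (sin t)\<^sup>2)"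
  shows "((\<lambda>t. sin t * cos t / sqrt (1 - m * (sin t)\<^sup>2)) has_real_derivative
           cos (2 * t) / d + m * (sin t)\<^sup>2 * (cos t)\<^sup>2 / d ^ 3) (at t within A)"
proof -
  have D: "0 < 1 - m * (sin t)\<^sup>2" using assms by (intro modulus_pos) auto
  have d: "d > 0" using D by (simp add: d_def)
  have 1: "((\<lambda>t. sqrt (1 - m * (sin t)\<^sup>2)) has_real_derivative - (m * sin t * cos t) / d) (at t within A)"
    unfolding d_def using D by (auto intro!: derivative_eq_intros simp: divide_simps)
  have "((\<lambda>t. sin t * cos t / sqrt (1 - m * (sin t)\<^sup>2)) has_real_derivative
     ((cos t * cos t - sin t * sin t) * d - sin t * cos t * (- (m * sin t * cos t) / d)) / (d * d)) (at t within A)"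
    using d unfolding d_def
    by (intro DERIV_divide 1[unfolded d_def]) (auto intro!: derivative_eq_intros)
  moreover have "((cos t * cos t - sin t * sin t) * d - sin t * cos t * (- (m * sin t * cos t) / d)) / (d * d)
     = cos (2 * t) / d + m * (sin t)\<^sup>2 * (cos t)\<^sup>2 / d ^ 3"
    using d unfolding cos_double by (simp add: field_simps power2_eq_square power3_eq_cube)
  ultimately show ?thesis by simp
qed

lemma integral_sin_cos_over_Delta:
  assumes "m < 1"
  shows "((\<lambda>t. cos (2 * t) / sqrt (1 - m * (sin t)\<^sup>2)
      + m * (sin t)\<^sup>2 * (cos t)\<^sup>2 / sqrt (1 - m * (sin t)\<^sup>2) ^ 3) has_integral 0) {0..pi/2}"
  using fundamental_theorem_of_calculus[of 0 "pi/2"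
      "\<lambda>t. sin t * cos t / sqrt (1 - m * (sin t)\<^sup>2)",
      OF _ sin_cos_over_Delta_deriv[OF assms, unfolded has_real_derivative_iff_has_vector_derivative]]
  by simp

text \<open>The integrand \<open>\<Delta> - (1 - m) / \<Delta>\<^sup>3\<close> is \<open>m\<close> times the derivative of \<open>sin t * cos t / \<Delta>\<close>.\<close>

lemma ellE_eq_ellJ:
  assumes "m < 1"
  shows "ellE m = (1 - m) * ellJ m"
proof -
  have eq: "sqrt (1 - m * (sin t)\<^sup>2) - (1 - m) * (1 / sqrt (1 - m * (sin t)\<^sup>2) ^ 3)
     = m * (cos (2 * t) / sqrt (1 - m * (sin t)\<^sup>2)
      + m * (sin t)\<^sup>2 * (cos t)\<^sup>2 / sqrt (1 - m * (sin t)\<^sup>2) ^ 3)" for t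
  proof -
    define d where "d = sqrt (1 - m * (sin t)\<^sup>2)"
    have D: "0 < 1 - m * (sin t)\<^sup>2" using assms by (intro modulus_pos) auto
    have d: "d > 0" "d * d = 1 - m * (sin t)\<^sup>2" using D by (simp_all add: d_def)
    have "(d * d) * (d * d) - (1 - m) = m * ((1 - 2 * (sin t)\<^sup>2) * (d * d) + m * (sin t)\<^sup>2 * (1 - (sin t)\<^sup>2))"
      unfolding d(2) by algebra
    moreover have "d - (1 - m) * (1 / d ^ 3) = ((d * d) * (d * d) - (1 - m)) / d ^ 3"
      using d(1) by (simp add: field_simps power3_eq_cube)
    moreover have "u / d + v / d ^ 3 = (u * (d * d) + v) / d ^ 3" for u v
      using d(1) by (simp add: field_simps power3_eq_cube)
    ultimately have "d - (1 - m) * (1 / d ^ 3)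
       = m * ((1 - 2 * (sin t)\<^sup>2) / d + m * (sin t)\<^sup>2 * (1 - (sin t)\<^sup>2) / d ^ 3)"
      by simp
    then show ?thesis
      by (simp add: d_def cos_double_sin cos_squared_eq)
  qed
  have "((\<lambda>t. sqrt (1 - m * (sin t)\<^sup>2) - (1 - m) * (1 / sqrt (1 - m * (sin t)\<^sup>2) ^ 3))
      has_integral (m * 0)) {0..pi/2}"
    unfolding eq by (rule has_integral_mult_right[OF integral_sin_cos_over_Delta[OF assms]])
  moreover have "((\<lambda>t. sqrt (1 - m * (sin t)\<^sup>2) - (1 - m) * (1 / sqrt (1 - m * (sin t)\<^sup>2) ^ 3))
      has_integral (ellE m - (1 - m) * ellJ m)) {0..pi/2}"
    unfolding ellE_def ellJ_def using ell_integrable[OF assms]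
    by (intro has_integral_diff has_integral_mult_right integrable_integral)
  ultimately have "m * 0 = ellE m - (1 - m) * ellJ m" by (rule has_integral_unique)
  then show ?thesis by simp
qed

text \<open>Pointwise, \<open>1/\<Delta>\<^sup>3 - 1/\<Delta> = m * (sin t)\<^sup>2 / \<Delta>\<^sup>3\<close>; the first integral is then
  expressed by \<open>ellE\<close>.\<close>

lemma ellK_deriv:
  assumes "m < 1" "m \<noteq> 0"
  shows "(ellK has_real_derivative (ellE m / (1 - m) - ellK m) / (2 * m)) (at m)"
proof -
  have "integral {0..pi/2} (\<lambda>t. (sin t)\<^sup>2 / (2 * sqrt (1 - m * (sin t)\<^sup>2) ^ 3))
      = integral {0..pi/2} (\<lambda>t. (1 / sqrt (1 - m * (sin t)\<^sup>2) ^ 3 - 1 / sqrt (1 - m * (sin t)\<^sup>2)) / (2 * m))"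
  proof (rule integral_cong)
    fix t :: real
    define d where "d = sqrt (1 - m * (sin t)\<^sup>2)"
    have D: "0 < 1 - m * (sin t)\<^sup>2" using assms by (intro modulus_pos) auto
    then have "d > 0" "m * (sin t)\<^sup>2 = 1 - d * d" by (simp_all add: d_def)
    then have "(sin t)\<^sup>2 / (2 * d ^ 3) = (1 / d ^ 3 - 1 / d) / (2 * m)"
      using assms by (simp add: field_simps power3_eq_cube)
    then show "(sin t)\<^sup>2 / (2 * sqrt (1 - m * (sin t)\<^sup>2) ^ 3)
      = (1 / sqrt (1 - m * (sin t)\<^sup>2) ^ 3 - 1 / sqrt (1 - m * (sin t)\<^sup>2)) / (2 * m)"
      by (simp add: d_def)
  qed
  also have "\<dots> = (ellJ m - ellK m) / (2 * m)"
    using ell_integrable[OF assms(1)] unfolding ellJ_def ellK_def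
    by (subst integral_divide, subst integral_diff) auto
  also have "ellJ m = ellE m / (1 - m)" using ellE_eq_ellJ[OF assms(1)] assms by simp
  finally show ?thesis using ellK_has_derivative_integral[OF assms(1)] by simp
qed

text \<open>The difference of the two sides is \<open>m\<close> times the integral of \<open>cos (2 t) / \<Delta>\<close>. This integral is negative
  because \<open>1/\<Delta>\<close> increases and so puts more weight where \<open>cos (2 t)\<close> is negative; integrating by parts with
  \<open>sin t * cos t / \<Delta>\<close> turns it into minus the integral of a positive function, which gives strictness.
  The inequality locates the inflection point of \<open>\<mu>\<close> below \<open>1 / \<surd>2\<close> and bounds \<open>ellK\<close> from above.\<close>

lemma ellE_upper:
  assumes "0 < m" "m < 1"
  shows "2 * ellE m < (2 - m) * ellK m"
proof -
  have "2 * ellE m - (2 - m) * ellK m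
     = integral {0..pi/2} (\<lambda>t. 2 * sqrt (1 - m * (sin t)\<^sup>2) - (2 - m) * (1 / sqrt (1 - m * (sin t)\<^sup>2)))"
    unfolding ellE_def ellK_def using ell_integrable[OF assms(2)]
    by (intro integral_unique[symmetric] has_integral_diff has_integral_mult_right integrable_integral)
  also have "\<dots> = integral {0..pi/2} (\<lambda>t. m * (cos (2 * t) / sqrt (1 - m * (sin t)\<^sup>2)))"
  proof (rule integral_cong)
    fix t :: real
    define d where "d = sqrt (1 - m * (sin t)\<^sup>2)"
    have D: "0 < 1 - m * (sin t)\<^sup>2" using assms by (intro modulus_pos) auto
    then have "d > 0" "d * d = 1 - m * (sin t)\<^sup>2" by (simp_all add: d_def)
    moreover have "2 * d - (2 - m) * (1 / d) = (2 * (d * d) - (2 - m)) / d"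
      using \<open>d > 0\<close> by (simp add: field_simps)
    ultimately have "2 * d - (2 - m) * (1 / d) = m * ((1 - 2 * (sin t)\<^sup>2) / d)"
      by (simp add: algebra_simps)
    then show "2 * sqrt (1 - m * (sin t)\<^sup>2) - (2 - m) * (1 / sqrt (1 - m * (sin t)\<^sup>2))
       = m * (cos (2 * t) / sqrt (1 - m * (sin t)\<^sup>2))"
      by (simp add: d_def cos_double_sin)
  qed
  also have "\<dots> = m * integral {0..pi/2} (\<lambda>t. cos (2 * t) / sqrt (1 - m * (sin t)\<^sup>2))"
    by (rule integral_mult_right)
  finally have eq: "2 * ellE m - (2 - m) * ellK m
     = m * integral {0..pi/2} (\<lambda>t. cos (2 * t) / sqrt (1 - m * (sin t)\<^sup>2))" .
  have "integral {0..pi/2} (\<lambda>t. cos (2 * t) / sqrt (1 - m * (sin t)\<^sup>2))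
     < integral {0..pi/2} (\<lambda>t. cos (2 * t) / sqrt (1 - m * (sin t)\<^sup>2)
      + m * (sin t)\<^sup>2 * (cos t)\<^sup>2 / sqrt (1 - m * (sin t)\<^sup>2) ^ 3)"
  proof (rule integral_less_real)
    fix t :: real assume t: "t \<in> {0<..<pi/2}"
    then have "sin t > 0" "cos t > 0" by (auto intro: sin_gt_zero cos_gt_zero)
    then have "0 < m * (sin t)\<^sup>2 * (cos t)\<^sup>2 / sqrt (1 - m * (sin t)\<^sup>2) ^ 3"
      using modulus_pos[OF assms(2), of t] assms(1)
      by (intro divide_pos_pos mult_pos_pos zero_less_power real_sqrt_gt_zero)
    then show "cos (2 * t) / sqrt (1 - m * (sin t)\<^sup>2)
      < cos (2 * t) / sqrt (1 - m * (sin t)\<^sup>2)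
      + m * (sin t)\<^sup>2 * (cos t)\<^sup>2 / sqrt (1 - m * (sin t)\<^sup>2) ^ 3"
      by linarith
  next
    show "continuous_on {0..pi/2} (\<lambda>t. cos (2 * t) / sqrt (1 - m * (sin t)\<^sup>2))"
      by (intro continuous_intros ballI sqrt_modulus_nonzero assms)
    show "continuous_on {0..pi/2} (\<lambda>t. cos (2 * t) / sqrt (1 - m * (sin t)\<^sup>2)
      + m * (sin t)\<^sup>2 * (cos t)\<^sup>2 / sqrt (1 - m * (sin t)\<^sup>2) ^ 3)"
      by (intro continuous_intros ballI power_not_zero sqrt_modulus_nonzero assms)
    show "{0<..<pi/2} \<noteq> {}" by (simp add: not_le)
  qed
  also have "\<dots> = 0" using integral_sin_cos_over_Delta[OF assms(2)] by (rule integral_unique)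
  finally have "m * integral {0..pi/2} (\<lambda>t. cos (2 * t) / sqrt (1 - m * (sin t)\<^sup>2)) < 0"
    using assms(1) by (rule mult_pos_neg[rotated])
  with eq show ?thesis by linarith
qed

text \<open>Pointwise, \<open>(1 - m) / \<Delta> \<le> \<Delta>\<close>, since \<open>1 - m \<le> \<Delta>\<^sup>2\<close>.\<close>

lemma ellE_lower:
  assumes "0 \<le> m" "m < 1"
  shows "(1 - m) * ellK m \<le> ellE m"
proof -
  have "(1 - m) * ellK m = integral {0..pi/2} (\<lambda>t. (1 - m) * (1 / sqrt (1 - m * (sin t)\<^sup>2)))"
    unfolding ellK_def by (rule integral_mult_right[symmetric])
  also have "\<dots> \<le> ellE m"
    unfolding ellE_def
  proof (rule integral_le)
    fix t :: real
    have "0 < 1 - m * (sin t)\<^sup>2" using assms by (intro modulus_pos) auto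
    moreover have "m * (sin t)\<^sup>2 \<le> m * 1"
      using assms by (intro mult_left_mono) (auto simp: abs_square_le_1)
    ultimately show "(1 - m) * (1 / sqrt (1 - m * (sin t)\<^sup>2)) \<le> sqrt (1 - m * (sin t)\<^sup>2)"
      by (simp add: field_simps)
  qed (intro integrable_on_mult_right ell_integrable assms)+
  finally show ?thesis .
qed

lemma modulus_antimono:
  fixes m n t :: real
  assumes "m \<le> n"
  shows "1 - n * (sin t)\<^sup>2 \<le> 1 - m * (sin t)\<^sup>2"
  using mult_right_mono[OF assms, of "(sin t)\<^sup>2"] by simp

lemma ellK_mono:
  assumes "m \<le> n" "n < 1"
  shows "ellK m \<le> ellK n"
  unfolding ellK_def
proof (rule integral_le)
  fix t :: real
  show "1 / sqrt (1 - m * (sin t)\<^sup>2) \<le> 1 / sqrt (1 - n * (sin t)\<^sup>2)"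
    using modulus_pos[OF assms(2), of t] modulus_antimono[OF assms(1), of t]
    by (intro frac_le) auto
qed (use assms in \<open>auto intro: ell_integrable\<close>)

lemma ellE_antimono:
  assumes "m \<le> n" "n < 1"
  shows "ellE n \<le> ellE m"
  unfolding ellE_def
  using assms modulus_antimono[OF assms(1)]
  by (intro integral_le ell_integrable real_sqrt_le_mono) auto

lemma ellK_0: "ellK 0 = pi / 2"
  by (simp add: ellK_def)

lemma ellK_pos:
  assumes "0 \<le> m" "m < 1"
  shows "0 < ellK m"
  using ellK_mono[OF assms] pi_gt_zero unfolding ellK_0 by linarith

lemma ellE_pos:
  assumes "0 \<le> m" "m < 1"
  shows "0 < ellE m"
  using ellE_lower[OF assms] mult_pos_pos[OF _ ellK_pos[OF assms], of "1 - m"] assms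
  by linarith

lemma ellK_isCont: "m < 1 \<Longrightarrow> isCont ellK m"
  and ellE_isCont: "m < 1 \<Longrightarrow> isCont ellE m"
  by (rule DERIV_isCont[OF ellK_has_derivative_integral] DERIV_isCont[OF ellE_has_derivative_integral]; assumption)+

section \<open>Legendre's relation\<close>

lemma ellK_complement_le:
  assumes "0 < m" "m < 1"
  shows "ellK (1 - m) \<le> pi / 2 / sqrt m"
proof -
  have "ellK (1 - m) \<le> integral {0..pi/2} (\<lambda>t. 1 / sqrt m)"
    unfolding ellK_def
  proof (rule integral_le)
    fix t :: real
    have "1 - (1 - m) * (sin t)\<^sup>2 = m + (1 - m) * (1 - (sin t)\<^sup>2)"
      by (simp add: algebra_simps)
    moreover have "0 \<le> (1 - m) * (1 - (sin t)\<^sup>2)"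
      using assms by (intro mult_nonneg_nonneg) (auto simp: abs_square_le_1)
    ultimately have "m \<le> 1 - (1 - m) * (sin t)\<^sup>2" by simp
    then show "1 / sqrt (1 - (1 - m) * (sin t)\<^sup>2) \<le> 1 / sqrt m"
      using assms by (intro frac_le real_sqrt_le_mono real_sqrt_gt_zero) auto
  qed (use assms in \<open>auto intro: ell_integrable\<close>)
  then show ?thesis by simp
qed

text \<open>Here \<open>\<Delta>\<^sup>2 = (cos t)\<^sup>2 + m * (sin t)\<^sup>2\<close>, so that \<open>cos t \<le> \<Delta> \<le> cos t + sqrt m * sin t\<close>. The bounds
  give \<open>E(1) = 1\<close> as a limit, at the point where the integrals cease to be differentiable.\<close>

lemma ellE_complement_bounds:
  assumes "0 < m" "m < 1"
  shows "1 \<le> ellE (1 - m)" "ellE (1 - m) \<le> 1 + sqrt m"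
proof -
  have sq: "1 - (1 - m) * (sin t)\<^sup>2 = (cos t)\<^sup>2 + m * (sin t)\<^sup>2" for t
    by (simp add: cos_squared_eq algebra_simps)
  have "(cos has_integral sin (pi/2) - sin 0) {0..pi/2}"
    by (intro fundamental_theorem_of_calculus)
      (auto intro!: derivative_eq_intros simp flip: has_real_derivative_iff_has_vector_derivative)
  then have c: "(cos has_integral 1) {0..pi/2}" by simp
  have "(sin has_integral - cos (pi/2) - - cos 0) {0..pi/2}"
    by (intro fundamental_theorem_of_calculus)
      (auto intro!: derivative_eq_intros simp flip: has_real_derivative_iff_has_vector_derivative)
  then have s: "(sin has_integral 1) {0..pi/2}" by simp
  have E: "((\<lambda>t. sqrt (1 - (1 - m) * (sin t)\<^sup>2)) has_integral ellE (1 - m)) {0..pi/2}"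
    unfolding ellE_def using assms by (intro integrable_integral ell_integrable) auto
  show "1 \<le> ellE (1 - m)"
  proof (rule has_integral_le[OF c E])
    fix t :: real
    show "cos t \<le> sqrt (1 - (1 - m) * (sin t)\<^sup>2)"
      unfolding sq using assms by (intro real_le_rsqrt) auto
  qed
  have cs: "((\<lambda>t. cos t + sqrt m * sin t) has_integral 1 + sqrt m * 1) {0..pi/2}"
    by (intro has_integral_add has_integral_mult_right c s)
  have "ellE (1 - m) \<le> 1 + sqrt m * 1"
  proof (rule has_integral_le[OF E cs])
    fix t :: real assume "t \<in> {0..pi/2}"
    then have "0 \<le> sin t" "0 \<le> cos t" by (auto intro: sin_ge_zero cos_ge_zero)
    then show "sqrt (1 - (1 - m) * (sin t)\<^sup>2) \<le> cos t + sqrt m * sin t"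
      unfolding sq using assms
      by (intro real_le_lsqrt) (auto simp: power2_sum power_mult_distrib)
  qed
  then show "ellE (1 - m) \<le> 1 + sqrt m" by simp
qed

text \<open>The left-hand side has derivative zero, and its value is found in the limit \<open>m \<rightarrow> 0\<close>. There
  \<open>ellE (1 - m) * ellK m\<close> tends to \<open>\<pi>/2\<close>, and the rest, \<open>(ellK m - ellE m) * ellK (1 - m)\<close>, is small since
  \<open>ellK m - ellE m = O(m)\<close> while \<open>ellK (1 - m) = O(1 / sqrt m)\<close>.\<close>

lemma legendre_relation:
  assumes "0 < m" "m < 1"
  shows "ellE m * ellK (1 - m) + ellE (1 - m) * ellK m - ellK m * ellK (1 - m) = pi / 2"
proof -
  define W where "W m = ellE m * ellK (1 - m) + ellE (1 - m) * ellK m - ellK m * ellK (1 - m)" for m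
  have "\<exists>c. \<forall>m\<in>{0<..<1}. W m = c"
  proof (rule has_field_derivative_zero_constant)
    fix m :: real assume "m \<in> {0<..<1}"
    then have m: "0 < m" "m < 1" by auto
    have K1: "((\<lambda>m. ellK (1 - m)) has_real_derivative
        (ellE (1 - m) / m - ellK (1 - m)) / (2 * (1 - m)) * (- 1)) (at m)"
      using m ellK_deriv[of "1 - m"]
      by (intro DERIV_chain2[of ellK]) (auto intro!: derivative_eq_intros)
    have E1: "((\<lambda>m. ellE (1 - m)) has_real_derivative
        (ellE (1 - m) - ellK (1 - m)) / (2 * (1 - m)) * (- 1)) (at m)"
      using m ellE_deriv[of "1 - m"]
      by (intro DERIV_chain2[of ellE]) (auto intro!: derivative_eq_intros)
    note K0 = ellK_deriv[of m] and E0 = ellE_deriv[of m]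
    have "(W has_real_derivative 0) (at m)"
      unfolding W_def[abs_def]
      by (rule derivative_eq_intros K1 E1 K0 E0 refl | use m in \<open>simp; fail\<close>)+
        (use m in \<open>simp add: divide_simps, algebra\<close>)
    then show "(W has_real_derivative 0) (at m within {0<..<1})"
      by (rule has_field_derivative_at_within)
  qed simp
  then obtain c where c: "\<And>m. 0 < m \<Longrightarrow> m < 1 \<Longrightarrow> W m = c" by auto
  have small: "\<forall>\<^sub>F m in at_right (0::real). 0 < m \<and> m < 1"
    using eventually_at_right_real[of 0 1] by simp
  have K: "(ellK \<longlongrightarrow> pi / 2) (at_right 0)"
    using ellK_isCont[of 0] unfolding isCont_def filterlim_at_split by (simp add: ellK_0)
  have sq: "((\<lambda>m. sqrt m) \<longlongrightarrow> 0) (at_right 0)"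
    using tendsto_real_sqrt[OF tendsto_ident_at, of 0 "{0<..}"] by simp
  have lim: "((\<lambda>m. 1 + sqrt m) \<longlongrightarrow> 1) (at_right 0)"
    using tendsto_add[OF tendsto_const sq, of 1] by simp
  have lower: "\<forall>\<^sub>F m in at_right 0. 1 \<le> ellE (1 - m)"
    using small by (rule eventually_mono) (auto intro: ellE_complement_bounds)
  have upper: "\<forall>\<^sub>F m in at_right 0. ellE (1 - m) \<le> 1 + sqrt m"
    using small by (rule eventually_mono) (auto intro: ellE_complement_bounds)
  have E1: "((\<lambda>m. ellE (1 - m)) \<longlongrightarrow> 1) (at_right 0)"
    by (rule tendsto_sandwich[OF lower upper tendsto_const lim])
  have "((\<lambda>m. (ellK m - ellE m) * ellK (1 - m)) \<longlongrightarrow> 0) (at_right 0)"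
  proof (rule tendsto_sandwich[where f = "\<lambda>_. 0" and h = "\<lambda>m. ellK m * (sqrt m * (pi / 2))"])
    show "\<forall>\<^sub>F m in at_right 0. 0 \<le> (ellK m - ellE m) * ellK (1 - m)"
      using small
    proof eventually_elim
      case (elim m)
      then have "0 < ellK m" "0 < ellK (1 - m)" by (auto intro: ellK_pos)
      moreover have "ellE m \<le> ellK m"
        using ellE_upper[of m] elim mult_pos_pos[of m "ellK m"] \<open>0 < ellK m\<close>
        unfolding left_diff_distrib by linarith
      ultimately show ?case by simp
    qed
    show "\<forall>\<^sub>F m in at_right 0. (ellK m - ellE m) * ellK (1 - m) \<le> ellK m * (sqrt m * (pi / 2))"
      using small
    proof eventually_elim
      case (elim m)
      then have K: "0 < ellK m" "0 < ellK (1 - m)" by (auto intro: ellK_pos)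
      have "ellK m - ellE m \<le> m * ellK m" using ellE_lower[of m] elim by (simp add: algebra_simps)
      then have "(ellK m - ellE m) * ellK (1 - m) \<le> (m * ellK m) * (pi / 2 / sqrt m)"
        using elim K by (intro mult_mono ellK_complement_le) auto
      also have "\<dots> = ellK m * ((m / sqrt m) * (pi / 2))" by (simp add: ac_simps)
      finally show ?case using elim by (simp add: real_div_sqrt)
    qed
    show "((\<lambda>_. 0 :: real) \<longlongrightarrow> 0) (at_right 0)" by simp
    show "((\<lambda>m. ellK m * (sqrt m * (pi / 2))) \<longlongrightarrow> 0) (at_right 0)"
      using tendsto_mult[OF K tendsto_mult[OF sq tendsto_const, of "pi/2"]] by simp
  qed
  from tendsto_diff[OF tendsto_mult[OF E1 K] this]
  have "(W \<longlongrightarrow> pi / 2) (at_right 0)"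
    unfolding W_def[abs_def] by (simp add: algebra_simps)
  moreover have "(W \<longlongrightarrow> c) (at_right 0)"
    using small by (intro tendsto_eventually) (auto elim!: eventually_mono intro: c)
  ultimately have "c = pi / 2" by (intro tendsto_unique[of "at_right (0::real)"]) auto
  then show ?thesis using c[OF assms] by (simp add: W_def)
qed

text \<open>The derivative of \<open>(1 - m) * ellK m ^ 4\<close> is a positive multiple of \<open>2 * ellE m - (2 - m) * ellK m < 0\<close>,
  and the value at zero is the right-hand side. In terms of the modulus \<open>r\<close> this says that
  \<open>r' K(r)\<^sup>2 < \<pi>\<^sup>2 / 4\<close>.\<close>

lemma ellK_upper:
  assumes "0 < m" "m < 1"
  shows "(1 - m) * ellK m ^ 4 < (pi / 2) ^ 4"
proof -
  have "(1 - m) * ellK m ^ 4 < (1 - 0) * ellK 0 ^ 4"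
  proof (rule DERIV_neg_imp_decreasing_open[where f = "\<lambda>m. (1 - m) * ellK m ^ 4"])
    show "0 < m" by fact
    fix k :: real assume k0: "0 < k" "k < m"
    with assms have k: "0 < k" "k < 1" by auto
    have "((\<lambda>m. (1 - m) * ellK m ^ 4) has_real_derivative
       ellK k ^ 3 / k * (2 * ellE k - (2 - k) * ellK k)) (at k)"
      by (rule derivative_eq_intros ellK_deriv refl | use k in \<open>simp; fail\<close>)+
        (use k in \<open>simp add: divide_simps, algebra\<close>)
    moreover have "ellK k ^ 3 / k * (2 * ellE k - (2 - k) * ellK k) < 0"
      using k ellK_pos[of k] ellE_upper[of k] by (intro mult_pos_neg) auto
    ultimately show "\<exists>y. ((\<lambda>m. (1 - m) * ellK m ^ 4) has_real_derivative y) (at k) \<and> y < 0"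
      by blast
  next
    have "continuous_on {0..m} ellK"
      using assms by (intro continuous_at_imp_continuous_on ballI ellK_isCont) auto
    then show "continuous_on {0..m} (\<lambda>m. (1 - m) * ellK m ^ 4)"
      by (intro continuous_intros)
  qed
  then show ?thesis by (simp add: ellK_0)
qed

section \<open>Derivatives of the modulus function\<close>

definition mu_deriv :: "real \<Rightarrow> real" where
  "mu_deriv r = - pi\<^sup>2 / (4 * r * (1 - r\<^sup>2) * (ellK (r\<^sup>2))\<^sup>2)"

text \<open>The factor of \<open>\<mu>''\<close> that decides its sign.\<close>

definition mu_convexity :: "real \<Rightarrow> real" where
  "mu_convexity r = 2 * ellE (r\<^sup>2) / ellK (r\<^sup>2) - (1 + r\<^sup>2)"

definition mu_deriv2 :: "real \<Rightarrow> real" where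
  "mu_deriv2 r = - mu_deriv r * mu_convexity r / (r * (1 - r\<^sup>2))"

lemma square_bounds:
  fixes r :: real
  assumes "0 < r" "r < 1"
  shows "0 < r\<^sup>2" "r\<^sup>2 < 1"
  using assms by (auto simp: power_less_one_iff abs_square_less_1)

lemma grotzsch_mu_eq:
  assumes "0 < r" "r < 1"
  shows "grotzsch_mu r = pi / 2 * (ellK (1 - r\<^sup>2) / ellK (r\<^sup>2))"
  using square_bounds[OF assms] by (simp add: grotzsch_mu_def elliptic_K_def ellK_def)

lemma grotzsch_mu_pos:
  assumes "0 < r" "r < 1"
  shows "0 < grotzsch_mu r"
  using square_bounds[OF assms] ellK_pos[of "r\<^sup>2"] ellK_pos[of "1 - r\<^sup>2"]
  by (simp add: grotzsch_mu_eq[OF assms])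

lemma mu_deriv_neg:
  assumes "0 < r" "r < 1"
  shows "mu_deriv r < 0"
  using square_bounds[OF assms] ellK_pos[of "r\<^sup>2"] assms
  by (auto simp: mu_deriv_def intro!: divide_pos_pos mult_pos_pos)

text \<open>By the quotient rule the numerator of the derivative is the left-hand side of Legendre's relation.\<close>

lemma grotzsch_mu_has_derivative:
  assumes "0 < r" "r < 1"
  shows "(grotzsch_mu has_real_derivative mu_deriv r) (at r)"
proof -
  define m where "m = r\<^sup>2"
  have m: "0 < m" "m < 1" using square_bounds[OF assms] by (simp_all add: m_def)
  have Kp: "ellK m > 0" using m by (intro ellK_pos) auto
  have sq: "((\<lambda>r. r\<^sup>2) has_real_derivative 2 * r) (at r)"
    by (auto intro!: derivative_eq_intros)
  have "((\<lambda>m. ellK (1 - m)) has_real_derivative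
        (ellE (1 - m) / m - ellK (1 - m)) / (2 * (1 - m)) * (- 1)) (at m)"
    using m ellK_deriv[of "1 - m"]
    by (intro DERIV_chain2[of ellK]) (auto intro!: derivative_eq_intros)
  then have "((\<lambda>m. pi / 2 * (ellK (1 - m) / ellK m)) has_real_derivative
        pi / 2 * (((ellE (1 - m) / m - ellK (1 - m)) / (2 * (1 - m)) * (- 1) * ellK m
          - ellK (1 - m) * ((ellE m / (1 - m) - ellK m) / (2 * m))) / (ellK m * ellK m))) (at m)"
    using m Kp by (intro DERIV_cmult DERIV_divide ellK_deriv) auto
  also have "pi / 2 * (((ellE (1 - m) / m - ellK (1 - m)) / (2 * (1 - m)) * (- 1) * ellK m
          - ellK (1 - m) * ((ellE m / (1 - m) - ellK m) / (2 * m))) / (ellK m * ellK m))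
     = - pi / 2 * (ellE m * ellK (1 - m) + ellE (1 - m) * ellK m - ellK m * ellK (1 - m))
        / (2 * m * (1 - m) * (ellK m)\<^sup>2)"
    using m Kp by (simp add: divide_simps) algebra
  also have "\<dots> = - pi\<^sup>2 / (8 * m * (1 - m) * (ellK m)\<^sup>2)"
    unfolding legendre_relation[OF m] by (simp add: power2_eq_square)
  finally have "((\<lambda>r. pi / 2 * (ellK (1 - r\<^sup>2) / ellK (r\<^sup>2))) has_real_derivative
        - pi\<^sup>2 / (8 * m * (1 - m) * (ellK m)\<^sup>2) * (2 * r)) (at r)"
    unfolding m_def by (rule DERIV_chain2[OF _ sq])
  also have "- pi\<^sup>2 / (8 * m * (1 - m) * (ellK m)\<^sup>2) * (2 * r) = mu_deriv r"
    using m Kp assms unfolding mu_deriv_def m_def[symmetric]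
    by (simp add: divide_simps) (simp add: m_def power2_eq_square)
  finally show ?thesis
    by (rule has_field_derivative_transform_within_open[of _ _ _ "{0<..<1}"])
      (use assms in \<open>auto simp: grotzsch_mu_eq\<close>)
qed

lemma mu_deriv_has_derivative:
  assumes "0 < r" "r < 1"
  shows "(mu_deriv has_real_derivative mu_deriv2 r) (at r)"
proof -
  define m where "m = r\<^sup>2"
  have m: "0 < m" "m < 1" using square_bounds[OF assms] by (simp_all add: m_def)
  have Kp: "ellK m > 0" using m by (intro ellK_pos) auto
  have sq: "((\<lambda>r. r\<^sup>2) has_real_derivative 2 * r) (at r)"
    by (auto intro!: derivative_eq_intros)
  have K: "((\<lambda>r. ellK (r\<^sup>2)) has_real_derivative
      (ellE m / (1 - m) - ellK m) / (2 * m) * (2 * r)) (at r)"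
    using ellK_deriv[of m] m unfolding m_def by (intro DERIV_chain2[OF _ sq]) auto
  have "((\<lambda>r. 4 * r * (1 - r\<^sup>2) * (ellK (r\<^sup>2))\<^sup>2) has_real_derivative
      4 * ellK m * (2 * ellE m - (1 + m) * ellK m)) (at r)"
    by (rule derivative_eq_intros K refl)+
      (use m Kp in \<open>simp add: m_def[symmetric] divide_simps, simp add: m_def, algebra\<close>)
  from DERIV_divide[OF DERIV_const this, of "- pi\<^sup>2"]
  have "(mu_deriv has_real_derivative
      (0 * (4 * r * (1 - r\<^sup>2) * (ellK (r\<^sup>2))\<^sup>2) - - pi\<^sup>2 * (4 * ellK m * (2 * ellE m - (1 + m) * ellK m)))
      / (4 * r * (1 - r\<^sup>2) * (ellK (r\<^sup>2))\<^sup>2 * (4 * r * (1 - r\<^sup>2) * (ellK (r\<^sup>2))\<^sup>2))) (at r)"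
    using m Kp assms unfolding mu_deriv_def[abs_def] by (simp add: m_def)
  moreover have "(0 * (4 * r * (1 - r\<^sup>2) * (ellK (r\<^sup>2))\<^sup>2) - - pi\<^sup>2 * (4 * ellK m * (2 * ellE m - (1 + m) * ellK m)))
      / (4 * r * (1 - r\<^sup>2) * (ellK (r\<^sup>2))\<^sup>2 * (4 * r * (1 - r\<^sup>2) * (ellK (r\<^sup>2))\<^sup>2)) = mu_deriv2 r"
    using m Kp assms unfolding mu_deriv2_def mu_deriv_def mu_convexity_def m_def[symmetric]
    by (simp add: divide_simps) algebra
  ultimately show ?thesis by simp
qed

text \<open>The quotient \<open>E / K\<close> decreases because \<open>E\<close> decreases and \<open>K\<close> increases; the term \<open>1 + r\<^sup>2\<close>
  makes the monotonicity strict.\<close>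

lemma mu_convexity_strict_antimono:
  assumes "0 < r" "r < s" "s < 1"
  shows "mu_convexity s < mu_convexity r"
proof -
  have sq: "r\<^sup>2 < s\<^sup>2" using assms by (intro power_strict_mono) auto
  have s: "0 < s\<^sup>2" "s\<^sup>2 < 1" using assms square_bounds[of s] by auto
  have "ellE (s\<^sup>2) / ellK (s\<^sup>2) \<le> ellE (r\<^sup>2) / ellK (r\<^sup>2)"
    using sq s ellK_pos[of "r\<^sup>2"] ellE_pos[of "s\<^sup>2"]
    by (intro frac_le ellE_antimono ellK_mono less_imp_le[OF ellE_pos]) auto
  then show ?thesis using sq by (simp add: mu_convexity_def)
qed

lemma mu_convexity_half: "0 < mu_convexity (1 / 2)"
proof -
  have "(1 - 1 / 4) * ellK (1 / 4) \<le> ellE (1 / 4)" "0 < ellK (1 / 4)"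
    by (intro ellE_lower ellK_pos; simp)+
  then show ?thesis
    by (simp add: mu_convexity_def power_divide field_simps)
qed

lemma mu_convexity_inv_sqrt2: "mu_convexity (1 / sqrt 2) < 0"
proof -
  have "2 * ellE (1 / 2) < (2 - 1 / 2) * ellK (1 / 2)" "0 < ellK (1 / 2)"
    by (intro ellE_upper ellK_pos; simp)+
  then show ?thesis
    by (simp add: mu_convexity_def power_divide field_simps)
qed

lemma mu_convexity_isCont:
  assumes "0 < r" "r < 1"
  shows "isCont mu_convexity r"
proof -
  have m: "0 < r\<^sup>2" "r\<^sup>2 < 1" using square_bounds[OF assms] .
  have sq: "isCont (\<lambda>r. r\<^sup>2) r" by (intro continuous_intros)
  have "isCont (\<lambda>r. ellK (r\<^sup>2)) r" "isCont (\<lambda>r. ellE (r\<^sup>2)) r"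
    by (rule isCont_o2[OF sq ellK_isCont[OF m(2)]] isCont_o2[OF sq ellE_isCont[OF m(2)]])+
  then show ?thesis
    using ellK_pos[of "r\<^sup>2"] m unfolding mu_convexity_def[abs_def]
    by (intro continuous_intros) auto
qed

lemma mu_deriv2_isCont:
  assumes "0 < r" "r < 1"
  shows "isCont mu_deriv2 r"
  using square_bounds[OF assms] assms mu_convexity_isCont[OF assms]
    DERIV_isCont[OF mu_deriv_has_derivative[OF assms]]
  unfolding mu_deriv2_def[abs_def] by (intro continuous_intros) auto

lemma deriv_grotzsch_mu:
  assumes "0 < r" "r < 1"
  shows "deriv grotzsch_mu r = mu_deriv r"
  using grotzsch_mu_has_derivative[OF assms] by (rule DERIV_imp_deriv)

lemma deriv_grotzsch_mu_has_derivative: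
  assumes "0 < r" "r < 1"
  shows "(deriv grotzsch_mu has_real_derivative mu_deriv2 r) (at r)"
  using mu_deriv_has_derivative[OF assms]
  by (rule has_field_derivative_transform_within_open[of _ _ _ "{0<..<1}"])
    (use assms in \<open>auto simp: deriv_grotzsch_mu\<close>)

lemma deriv2_grotzsch_mu:
  assumes "0 < r" "r < 1"
  shows "deriv (deriv grotzsch_mu) r = mu_deriv2 r"
  using deriv_grotzsch_mu_has_derivative[OF assms] by (rule DERIV_imp_deriv)

lemma mu_deriv2_sign:
  assumes "0 < r" "r < 1"
  shows "0 < mu_deriv2 r \<longleftrightarrow> 0 < mu_convexity r"
    and "mu_deriv2 r < 0 \<longleftrightarrow> mu_convexity r < 0"
proof -
  define c where "c = - mu_deriv r / (r * (1 - r\<^sup>2))"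
  have "c > 0" using mu_deriv_neg[OF assms] square_bounds[OF assms] assms
    unfolding c_def by (intro divide_pos_pos mult_pos_pos) auto
  moreover have "mu_deriv2 r = c * mu_convexity r" by (simp add: mu_deriv2_def c_def)
  ultimately show "0 < mu_deriv2 r \<longleftrightarrow> 0 < mu_convexity r" "mu_deriv2 r < 0 \<longleftrightarrow> mu_convexity r < 0"
    by (auto simp: zero_less_mult_iff mult_less_0_iff)
qed

section \<open>The inflection point\<close>

lemma mu_inflection_unique:
  assumes "mu_inflection a" "mu_inflection b"
  shows "a = b"
proof -
  have "\<not> a < b" if ab: "mu_inflection a" "mu_inflection b" for a b
  proof
    assume "a < b"
    then obtain r where "a < r" "r < b" using dense by blast
    then show False using ab unfolding mu_inflection_def
      by (smt (verit, best))
  qed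
  then show ?thesis using assms by (meson linorder_neqE)
qed

lemma mu_inflection_exists:
  obtains a where "mu_inflection a" "1 / 2 < a" "a < 1 / sqrt 2"
proof -
  have s: "1 / 2 < 1 / sqrt 2" "1 / sqrt 2 < (1 :: real)"
    using sqrt2_less_2 by (simp_all add: frac_less2)
  have "\<exists>a\<ge>1/2. a \<le> 1 / sqrt 2 \<and> mu_convexity a = 0"
  proof (rule IVT2)
    show "\<forall>r. 1 / 2 \<le> r \<and> r \<le> 1 / sqrt 2 \<longrightarrow> isCont mu_convexity r"
    proof (intro allI impI)
      fix r :: real assume "1 / 2 \<le> r \<and> r \<le> 1 / sqrt 2"
      then have "0 < r" "r < 1" using s(2) by linarith+
      then show "isCont mu_convexity r" by (rule mu_convexity_isCont)
    qed
  qed (use s(1) mu_convexity_half mu_convexity_inv_sqrt2 in auto)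
  then obtain a where a: "1 / 2 \<le> a" "a \<le> 1 / sqrt 2" "mu_convexity a = 0" by blast
  have "a \<noteq> 1 / 2" "a \<noteq> 1 / sqrt 2"
    using a(3) mu_convexity_half mu_convexity_inv_sqrt2 by (metis less_irrefl)+
  with a have a': "1 / 2 < a" "a < 1 / sqrt 2" "a < 1" using s by linarith+
  have "mu_inflection a"
    unfolding mu_inflection_def
  proof (intro conjI allI impI)
    fix r assume r: "0 < r \<and> r < a"
    then have "0 < mu_convexity r" using mu_convexity_strict_antimono[of r a] a a' by auto
    then show "0 < deriv (deriv grotzsch_mu) r" using r a' by (simp add: deriv2_grotzsch_mu mu_deriv2_sign)
  next
    fix r assume r: "a < r \<and> r < 1"
    then have "mu_convexity r < 0" using mu_convexity_strict_antimono[of a r] a a' by auto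
    then show "deriv (deriv grotzsch_mu) r < 0" using r a' by (simp add: deriv2_grotzsch_mu mu_deriv2_sign)
  qed (use a' in auto)
  then show thesis using a' that by blast
qed

section \<open>The inverse function and the starting point\<close>

lemma grotzsch_mu_strict_antimono:
  assumes "0 < r" "r < s" "s < 1"
  shows "grotzsch_mu s < grotzsch_mu r"
  using assms
  by (intro DERIV_neg_imp_decreasing[of r s grotzsch_mu])
    (auto intro!: exI[of _ "mu_deriv _"] grotzsch_mu_has_derivative mu_deriv_neg)

text \<open>At \<open>r = 1 / \<surd>2\<close> the modulus and its complement coincide.\<close>

lemma grotzsch_mu_inv_sqrt2: "grotzsch_mu (1 / sqrt 2) = pi / 2"
  using ellK_pos[of "1/2"] by (subst grotzsch_mu_eq) (auto simp: power_divide)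

text \<open>With \<open>q = 1 / cosh u\<close> one has \<open>q' = sinh u / cosh u\<close>, so the derivative of \<open>\<mu> (1 / cosh u) - u\<close> is
  \<open>\<pi>\<^sup>2 / (4 q' K(q)\<^sup>2) - 1\<close>, which is positive by the upper bound for \<open>ellK\<close>. The function is
  therefore strictly increasing. As \<open>\<mu> > 0\<close>, its value at \<open>u\<close> is at least \<open>- u\<close>, so a negative value
  anywhere would contradict monotonicity close to zero.\<close>

lemma grotzsch_mu_sech_greater:
  assumes "0 < t"
  shows "t < grotzsch_mu (1 / cosh t)"
proof -
  have r: "0 < 1 / cosh t" "1 / cosh t < 1" if "0 < t" for t :: real
    using that cosh_real_strict_mono[of 0 t] by auto
  define G where "G t = grotzsch_mu (1 / cosh t) - t" for t
  have mono: "G s < G t" if "0 < s" "s < t" for s t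
  proof (rule DERIV_pos_imp_increasing[OF that(2)])
    fix u assume "s \<le> u" "u \<le> t"
    then have u: "0 < u" using that by simp
    define q where "q = 1 / cosh u"
    have q: "0 < q" "q < 1" using r[OF u] by (simp_all add: q_def)
    have c: "cosh u > 0" by simp
    have sh: "sinh u > 0" using u by simp
    have q2: "1 - q\<^sup>2 = (sinh u / cosh u)\<^sup>2"
      using c by (simp add: q_def power_divide sinh_square_eq diff_divide_distrib)
    have sq: "0 < q\<^sup>2" "q\<^sup>2 < 1" using square_bounds[OF q] .
    define K where "K = ellK (q\<^sup>2)"
    have K: "0 < K" using sq unfolding K_def by (intro ellK_pos) auto
    define th where "th = sinh u / cosh u"
    have th: "0 < th" using c sh by (simp add: th_def)
    have "(th * K\<^sup>2)\<^sup>2 = (1 - q\<^sup>2) * K ^ 4"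
      unfolding q2 th_def[symmetric] by (simp add: power_mult_distrib)
    also have "\<dots> < (pi / 2) ^ 4" unfolding K_def by (rule ellK_upper[OF sq])
    also have "(pi / 2) ^ 4 = ((pi / 2)\<^sup>2)\<^sup>2" by simp
    finally have "th * K\<^sup>2 < (pi / 2)\<^sup>2" by (rule power_less_imp_less_base) simp
    then have less: "4 * (th * K\<^sup>2) < pi\<^sup>2" by (simp add: power_divide)
    have "((\<lambda>u. 1 / cosh u) has_real_derivative - sinh u / (cosh u)\<^sup>2) (at u)"
      using c by (auto intro!: derivative_eq_intros simp: power2_eq_square)
    moreover have "(grotzsch_mu has_real_derivative mu_deriv q) (at (1 / cosh u))"
      using grotzsch_mu_has_derivative[OF q] by (simp add: q_def)
    ultimately have "((\<lambda>u. grotzsch_mu (1 / cosh u)) has_real_derivative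
        mu_deriv q * (- sinh u / (cosh u)\<^sup>2)) (at u)"
      by (rule DERIV_chain2[rotated])
    then have "(G has_real_derivative mu_deriv q * (- sinh u / (cosh u)\<^sup>2) - 1) (at u)"
      unfolding G_def[abs_def] by (intro DERIV_diff DERIV_ident)
    moreover have "mu_deriv q * (- sinh u / (cosh u)\<^sup>2) = pi\<^sup>2 / (4 * (th * K\<^sup>2))"
    proof -
      have "sinh u / (cosh u)\<^sup>2 = q * th"
        by (simp add: q_def th_def power2_eq_square)
      then have "mu_deriv q * (- sinh u / (cosh u)\<^sup>2) = - mu_deriv q * (q * th)" by simp
      then show ?thesis
        unfolding mu_deriv_def K_def[symmetric] q2 th_def[symmetric]
        using q th K by (simp add: power2_eq_square)
    qed
    moreover have "pi\<^sup>2 / (4 * (th * K\<^sup>2)) > 1" using less th K by (simp add: less_divide_eq)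
    ultimately show "\<exists>y. (G has_real_derivative y) (at u) \<and> y > 0"
      by (metis diff_gt_0_iff_gt)
  qed
  have "0 \<le> G (t / 2)"
  proof (rule ccontr)
    assume neg: "\<not> 0 \<le> G (t / 2)"
    \<comment> \<open>A point left of \<open>t / 2\<close> at which the lower bound \<open>- s\<close> is already
      at least the supposed negative value.\<close>
    define s where "s = min (t / 4) (- G (t / 2))"
    have s: "0 < s" "s < t / 2" "s \<le> - G (t / 2)" using neg assms by (auto simp: s_def)
    have "G s > - s" using grotzsch_mu_pos[OF r[OF s(1)]] by (simp add: G_def)
    moreover have "G s < G (t / 2)" using mono s by auto
    ultimately show False using s by linarith
  qed
  also have "G (t / 2) < G t" using assms by (intro mono) auto
  finally show ?thesis by (simp add: G_def)
qed

section \<open>Newton's method in one variable\<close>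

text \<open>The mean value theorem replaces \<open>g x - g p\<close> by \<open>(x - p) * g' z\<close>.\<close>

lemma newton_step_error:
  fixes g g' :: "real \<Rightarrow> real"
  assumes "x \<noteq> p" "g' x \<noteq> 0"
    and der: "\<And>z. min x p \<le> z \<Longrightarrow> z \<le> max x p \<Longrightarrow> (g has_real_derivative g' z) (at z)"
  obtains z where "min x p < z" "z < max x p"
    and "x - (g x - g p) / g' x - p = (x - p) * (1 - g' z / g' x)"
proof -
  obtain z where z: "min x p < z" "z < max x p" "g x - g p = (x - p) * g' z"
  proof (cases "x < p")
    case True
    then show thesis using MVT2[OF True der] that by (force simp: algebra_simps)
  next
    case False
    then have "p < x" using assms(1) by simp
    then show thesis using MVT2[OF _ der, of p x] that by force
  qed
  have "x - (g x - g p) / g' x - p = (x - p) * (1 - g' z / g' x)"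
    unfolding z(3) by (simp add: right_diff_distrib)
  with z that show thesis by blast
qed

lemma newton_limit_is_root:
  fixes g g' :: "real \<Rightarrow> real"
  assumes X: "X \<longlonglongrightarrow> L" and step: "\<And>n. X (Suc n) = X n - (g (X n) - y) / g' (X n)"
    and "isCont g L" "isCont g' L" "g' L \<noteq> 0"
  shows "g L = y"
proof -
  have "(\<lambda>n. X n - (g (X n) - y) / g' (X n)) \<longlonglongrightarrow> L - (g L - y) / g' L"
    using assms by (intro tendsto_intros isCont_tendsto_compose[OF _ X]) auto
  then have "(\<lambda>n. X (Suc n)) \<longlonglongrightarrow> L - (g L - y) / g' L" by (simp add: step)
  moreover have "(\<lambda>n. X (Suc n)) \<longlonglongrightarrow> L" using X by (rule LIMSEQ_Suc)
  ultimately have "L - (g L - y) / g' L = L" by (rule LIMSEQ_unique)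
  then show ?thesis using \<open>g' L \<noteq> 0\<close> by simp
qed

text \<open>In the error formula the factor \<open>1 - g' z / g' x\<close> is \<open>(g' x - g' z) / g' x\<close>; its numerator is at most
  \<open>\<bar>x - p\<bar>\<close> times a bound of \<open>\<bar>g''\<bar>\<close> near \<open>p\<close>, and its denominator stays away from zero.\<close>

lemma newton_eventually_quadratic:
  fixes g g' g'' :: "real \<Rightarrow> real"
  assumes X: "X \<longlonglongrightarrow> p" and step: "\<And>n. X (Suc n) = X n - (g (X n) - g p) / g' (X n)"
    and S: "open S" "p \<in> S"
    and g: "\<And>z. z \<in> S \<Longrightarrow> (g has_real_derivative g' z) (at z)"
    and g': "\<And>z. z \<in> S \<Longrightarrow> (g' has_real_derivative g'' z) (at z)"
    and "isCont g'' p" "g' p \<noteq> 0"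
  shows "\<exists>C>0. \<exists>N. \<forall>n\<ge>N. \<bar>X (Suc n) - p\<bar> \<le> C * \<bar>X n - p\<bar>\<^sup>2"
proof -
  define B where "B = \<bar>g'' p\<bar> + 1"
  define b where "b = \<bar>g' p\<bar> / 2"
  have b: "0 < b" using \<open>g' p \<noteq> 0\<close> by (simp add: b_def)
  have B: "0 < B" by (simp add: B_def)
  have cg': "isCont g' p" using g'[OF S(2)] by (rule DERIV_isCont)
  have "(\<lambda>z. \<bar>g'' z\<bar>) \<midarrow>p\<rightarrow> \<bar>g'' p\<bar>" "(\<lambda>z. \<bar>g' z\<bar>) \<midarrow>p\<rightarrow> \<bar>g' p\<bar>"
    using \<open>isCont g'' p\<close> cg' unfolding isCont_def by (auto intro: tendsto_rabs)
  then have "\<forall>\<^sub>F z in nhds p. \<bar>g'' z\<bar> < B" "\<forall>\<^sub>F z in nhds p. b < \<bar>g' z\<bar>"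
    using b \<open>g' p \<noteq> 0\<close> order_tendstoD(2)[of _ "\<bar>g'' p\<bar>" _ B] order_tendstoD(1)[of _ "\<bar>g' p\<bar>" _ b]
    by (simp_all add: eventually_nhds_conv_at B_def b_def)
  moreover have "\<forall>\<^sub>F z in nhds p. z \<in> S" using S by (rule eventually_nhds_in_open)
  ultimately have "\<forall>\<^sub>F z in nhds p. z \<in> S \<and> \<bar>g'' z\<bar> < B \<and> b < \<bar>g' z\<bar>"
    by eventually_elim auto
  then obtain d where d: "d > 0"
    and near: "\<And>z. \<bar>z - p\<bar> < d \<Longrightarrow> z \<in> S \<and> \<bar>g'' z\<bar> < B \<and> b < \<bar>g' z\<bar>"
    unfolding eventually_nhds_metric dist_real_def by blast
  obtain N where N: "\<And>n. n \<ge> N \<Longrightarrow> \<bar>X n - p\<bar> < d"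
    using X d unfolding LIMSEQ_def dist_real_def by blast
  have "\<bar>X (Suc n) - p\<bar> \<le> B / b * \<bar>X n - p\<bar>\<^sup>2" if "n \<ge> N" for n
  proof (cases "X n = p")
    case True
    then show ?thesis by (simp add: step)
  next
    case False
    define x where "x = X n"
    have x: "\<bar>x - p\<bar> < d" "x \<noteq> p" using N[OF that] False by (auto simp: x_def)
    have g'x: "b < \<bar>g' x\<bar>" using near[OF x(1)] by simp
    then have "g' x \<noteq> 0" using b by auto
    obtain z where z: "min x p < z" "z < max x p"
      and err: "x - (g x - g p) / g' x - p = (x - p) * (1 - g' z / g' x)"
    proof (rule newton_step_error[of x p g' g, OF x(2) \<open>g' x \<noteq> 0\<close>])
      fix w assume "min x p \<le> w" "w \<le> max x p"
      then have "\<bar>w - p\<bar> < d" using x(1) by (auto simp: min_def max_def split: if_splits)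
      then show "(g has_real_derivative g' w) (at w)" using near g by blast
    qed
    have zp: "\<bar>z - p\<bar> < d" and zx: "\<bar>x - z\<bar> \<le> \<bar>x - p\<bar>"
      using z x(1) by (auto simp: min_def max_def split: if_splits)
    have "norm (g' x - g' z) \<le> B * norm (x - z)"
    proof (rule field_differentiable_bound[of "ball p d" g' g''])
      fix w assume "w \<in> ball p d"
      then have w: "\<bar>w - p\<bar> < d" by (simp add: dist_real_def abs_minus_commute)
      show "(g' has_field_derivative g'' w) (at w within ball p d)"
        using near[OF w] g' by (blast intro: has_field_derivative_at_within)
      show "norm (g'' w) \<le> B" using near[OF w] by simp
    qed (use x zp in \<open>auto simp: dist_real_def abs_minus_commute\<close>)
    then have diff: "\<bar>g' x - g' z\<bar> \<le> B * \<bar>x - p\<bar>"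
      using mult_left_mono[OF zx, of B] B by (simp only: real_norm_def) linarith
    have "1 - g' z / g' x = (g' x - g' z) / g' x"
      using \<open>g' x \<noteq> 0\<close> by (simp add: diff_divide_distrib)
    then have "\<bar>1 - g' z / g' x\<bar> = \<bar>g' x - g' z\<bar> / \<bar>g' x\<bar>" by (simp only: abs_divide)
    also have "\<dots> \<le> (B * \<bar>x - p\<bar>) / b"
      using diff g'x b by (intro frac_le) auto
    finally have "\<bar>x - p\<bar> * \<bar>1 - g' z / g' x\<bar> \<le> \<bar>x - p\<bar> * ((B * \<bar>x - p\<bar>) / b)"
      by (intro mult_left_mono) auto
    also have "\<dots> = B / b * \<bar>x - p\<bar>\<^sup>2" by (simp add: power2_eq_square)
    finally have "\<bar>(x - p) * (1 - g' z / g' x)\<bar> \<le> B / b * \<bar>x - p\<bar>\<^sup>2"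
      by (simp only: abs_mult)
    then have "\<bar>x - (g x - g p) / g' x - p\<bar> \<le> B / b * \<bar>x - p\<bar>\<^sup>2"
      unfolding err .
    then show ?thesis by (simp add: step x_def)
  qed
  then show ?thesis using B b by (intro exI[of _ "B / b"]) auto
qed

section \<open>Newton steps for the modulus function\<close>

text \<open>The Newton map is parametrized by the root \<open>p\<close> instead of the target value \<open>y = \<mu> p\<close>.\<close>

definition mu_newton :: "real \<Rightarrow> real \<Rightarrow> real" where
  "mu_newton p x = x - (grotzsch_mu x - grotzsch_mu p) / deriv grotzsch_mu x"

lemma deriv_mu_neg:
  assumes "0 < r" "r < 1"
  shows "deriv grotzsch_mu r < 0"
  using mu_deriv_neg[OF assms] by (simp add: deriv_grotzsch_mu[OF assms])

lemma mu_newton_error: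
  assumes "0 < x" "x < 1" "0 < p" "p < 1" "x \<noteq> p"
  obtains z where "min x p < z" "z < max x p"
    and "mu_newton p x - p = (x - p) * (1 - deriv grotzsch_mu z / deriv grotzsch_mu x)"
proof (rule newton_step_error[of x p "deriv grotzsch_mu" grotzsch_mu])
  show "deriv grotzsch_mu x \<noteq> 0" using deriv_mu_neg[of x] assms by simp
  fix z assume "min x p \<le> z" "z \<le> max x p"
  then have "0 < z" "z < 1" using assms by (auto simp: min_def max_def split: if_splits)
  then show "(grotzsch_mu has_real_derivative deriv grotzsch_mu z) (at z)"
    using grotzsch_mu_has_derivative deriv_grotzsch_mu by metis
qed (use assms that in \<open>auto simp: mu_newton_def\<close>)

text \<open>The cubic \<open>t * (1 - t\<^sup>2)\<close> rises up to \<open>1 / \<surd>3\<close> and has fallen only slightly at \<open>1 / \<surd>2\<close>. The optimal constant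
  is about \<open>1.09\<close>; the value \<open>4/3\<close> is simpler and still small enough to keep the Newton steps inside
  \<open>(0, 1)\<close>.\<close>

lemma cubic_ratio_bound:
  fixes x z :: real
  assumes "0 < x" "x \<le> z" "z\<^sup>2 \<le> 1 / 2"
  shows "x * (1 - x\<^sup>2) \<le> 4 / 3 * (z * (1 - z\<^sup>2))"
proof -
  have z: "0 < z" using assms by simp
  have "x\<^sup>2 \<le> x * z" using assms by (simp add: power2_eq_square)
  then have "x\<^sup>2 + x * z + z\<^sup>2 - 1 \<le> z * (2 * x - z)"
    using assms(3) by (simp add: algebra_simps power2_eq_square)
  then have "(z - x) * (x\<^sup>2 + x * z + z\<^sup>2 - 1) \<le> (z - x) * (z * (2 * x - z))"
    using assms by (intro mult_left_mono) auto
  \<comment> \<open>Completing the square in \<open>x\<close>; the maximum over \<open>x\<close> is at \<open>3/4 * z\<close>.\<close>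
  also have "\<dots> = z * (z\<^sup>2 / 8 - 2 * (x - 3 / 4 * z)\<^sup>2)"
    by (simp add: algebra_simps power2_eq_square)
  also have "\<dots> \<le> z * ((1 - z\<^sup>2) / 3)"
  proof (intro mult_left_mono)
    have "w / 8 - 2 * u \<le> (1 - w) / 3" if "0 \<le> u" "w \<le> 1 / 2" for u w :: real
      using that by (simp add: field_simps)
    from this[OF zero_le_power2 assms(3)]
    show "z\<^sup>2 / 8 - 2 * (x - 3 / 4 * z)\<^sup>2 \<le> (1 - z\<^sup>2) / 3" .
  qed (use z in simp)
  finally show ?thesis
    by (simp add: algebra_simps power2_eq_square)
qed

text \<open>In the closed form of \<open>\<mu>'\<close> the factor \<open>K\<close> is larger at \<open>z\<close> than at \<open>x\<close>, so it can only decrease the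
  quotient, and what remains is the quotient of the cubics.\<close>

lemma deriv_mu_ratio_bound:
  assumes "0 < x" "x \<le> z" "z\<^sup>2 \<le> 1 / 2"
  shows "deriv grotzsch_mu z / deriv grotzsch_mu x \<le> 4 / 3"
proof -
  have z2: "z\<^sup>2 < 1" using assms by simp
  have z: "0 < z" "z < 1" "x < 1" using assms z2 by (auto simp: abs_square_less_1)
  have x2: "0 < x\<^sup>2" "x\<^sup>2 < 1" "0 < z\<^sup>2" using assms z by (auto simp: abs_square_less_1)
  define Kx Kz where "Kx = (ellK (x\<^sup>2))\<^sup>2" and "Kz = (ellK (z\<^sup>2))\<^sup>2"
  have Kx: "0 < Kx" using ellK_pos[of "x\<^sup>2"] x2 by (simp add: Kx_def)
  have "x\<^sup>2 \<le> z\<^sup>2" using assms by (intro power_mono) auto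
  from ellK_mono[OF this z2] have le: "Kx \<le> Kz" unfolding Kx_def Kz_def
    by (rule power_mono) (use ellK_pos[of "x\<^sup>2"] x2 in linarith)
  have "x * (1 - x\<^sup>2) * Kx \<le> 4 / 3 * (z * (1 - z\<^sup>2)) * Kz"
    by (rule mult_mono[OF cubic_ratio_bound[OF assms] le]) (use z z2 Kx in auto)
  moreover have "deriv grotzsch_mu z / deriv grotzsch_mu x
     = (x * (1 - x\<^sup>2) * Kx) / (z * (1 - z\<^sup>2) * Kz)"
    using z assms x2 z2 Kx le
    by (simp add: deriv_grotzsch_mu mu_deriv_def Kx_def[symmetric] Kz_def[symmetric])
  moreover have "0 < z * (1 - z\<^sup>2) * Kz"
    using z z2 Kx le by (intro mult_pos_pos) auto
  ultimately show ?thesis by (simp add: pos_divide_le_eq mult.assoc)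
qed

lemma inv_sqrt2_less: "1 / sqrt 2 < (3 / 4 :: real)"
proof -
  have "(4 / 3 :: real) < sqrt 2" by (rule real_less_rsqrt) (simp add: power2_eq_square)
  then show ?thesis by (simp add: field_simps)
qed

text \<open>The step has length \<open>q * (p - x)\<close>, where \<open>q\<close> is the quotient of the derivatives and \<open>0 < q \<le> 4/3\<close>,
  so it ends no further right than \<open>x + 4/3 * (p - x) < 4/3 * p < 1\<close>. This covers in particular the steps
  that start left of the inflection point and aim at a root right of it.\<close>

lemma mu_newton_from_left:
  assumes "0 < x" "x < p" "p \<le> 1 / sqrt 2"
  shows "x < mu_newton p x" "mu_newton p x < 1"
proof -
  have p: "p < 3 / 4" using assms inv_sqrt2_less by simp
  obtain z where z: "x < z" "z < p"
    and err: "mu_newton p x - p = (x - p) * (1 - deriv grotzsch_mu z / deriv grotzsch_mu x)"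
    using mu_newton_error[of x p] assms p by auto
  define q where "q = deriv grotzsch_mu z / deriv grotzsch_mu x"
  have "0 < q" using deriv_mu_neg[of z] deriv_mu_neg[of x] assms p z
    unfolding q_def by (intro divide_neg_neg) auto
  have "z\<^sup>2 \<le> (1 / sqrt 2)\<^sup>2" using z assms by (intro power_mono) auto
  then have "q \<le> 4 / 3" unfolding q_def using z assms
    by (intro deriv_mu_ratio_bound) (auto simp: power_divide)
  have eq: "mu_newton p x = x + (p - x) * q"
    using err unfolding q_def[symmetric] by (simp add: algebra_simps)
  show "x < mu_newton p x" using eq \<open>0 < q\<close> assms by simp
  have "(p - x) * q \<le> (p - x) * (4 / 3)"
    using \<open>q \<le> 4 / 3\<close> assms by (intro mult_left_mono) auto
  then show "mu_newton p x < 1" using eq assms p by simp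
qed

lemma deriv_mu_less_left_of_inflection:
  assumes "mu_inflection a" "0 < x" "x < z" "z \<le> a"
  shows "deriv grotzsch_mu x < deriv grotzsch_mu z"
proof (rule DERIV_pos_imp_increasing_open[OF assms(3)])
  have a: "a < 1" "\<And>r. 0 < r \<Longrightarrow> r < a \<Longrightarrow> 0 < mu_deriv2 r"
    using assms(1) deriv2_grotzsch_mu unfolding mu_inflection_def by auto
  show "\<exists>d. (deriv grotzsch_mu has_real_derivative d) (at r) \<and> 0 < d" if "x < r" "r < z" for r
    using deriv_grotzsch_mu_has_derivative[of r] a(1) a(2)[of r] that assms by auto
  show "continuous_on {x..z} (deriv grotzsch_mu)"
    by (intro continuous_at_imp_continuous_on ballI
        DERIV_isCont[OF deriv_grotzsch_mu_has_derivative]) (use assms a in auto)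
qed

lemma deriv_mu_less_right_of_inflection:
  assumes "mu_inflection a" "a \<le> x" "x < z" "z < 1"
  shows "deriv grotzsch_mu z < deriv grotzsch_mu x"
proof (rule DERIV_neg_imp_decreasing_open[OF assms(3)])
  have a: "0 < a" "\<And>r. a < r \<Longrightarrow> r < 1 \<Longrightarrow> mu_deriv2 r < 0"
    using assms(1) deriv2_grotzsch_mu unfolding mu_inflection_def by auto
  show "\<exists>d. (deriv grotzsch_mu has_real_derivative d) (at r) \<and> d < 0" if "x < r" "r < z" for r
    using deriv_grotzsch_mu_has_derivative[of r] a(1) a(2)[of r] that assms by auto
  show "continuous_on {x..z} (deriv grotzsch_mu)"
    by (intro continuous_at_imp_continuous_on ballI
        DERIV_isCont[OF deriv_grotzsch_mu_has_derivative]) (use assms a in auto)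
qed

text \<open>In the error formula the quotient of the derivatives is less than one, as \<open>\<mu>'\<close> is negative and
  increasing up to \<open>a\<close>: the tangent at \<open>x\<close> lies below the graph.\<close>

lemma mu_newton_convex_left:
  assumes "mu_inflection a" "0 < x" "x < p" "p \<le> a"
  shows "mu_newton p x < p"
proof -
  have a: "a < 1" using assms(1) by (simp add: mu_inflection_def)
  obtain z where z: "x < z" "z < p"
    and err: "mu_newton p x - p = (x - p) * (1 - deriv grotzsch_mu z / deriv grotzsch_mu x)"
    using mu_newton_error[of x p] assms a by auto
  have "deriv grotzsch_mu x < deriv grotzsch_mu z"
    using assms z by (intro deriv_mu_less_left_of_inflection[of a]) auto
  then have "0 < 1 - deriv grotzsch_mu z / deriv grotzsch_mu x"
    using deriv_mu_neg[of x] assms a by (simp add: divide_less_eq)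
  then have "(x - p) * (1 - deriv grotzsch_mu z / deriv grotzsch_mu x) < 0"
    using assms by (intro mult_neg_pos) auto
  then show ?thesis using err by simp
qed

text \<open>The quotient of the derivatives exceeds one: the tangent lies above the graph and meets the level of \<open>p\<close> only
  beyond \<open>p\<close>.\<close>

lemma mu_newton_concave_left:
  assumes "mu_inflection a" "a \<le> x" "x < p" "p < 1"
  shows "p < mu_newton p x"
proof -
  have a: "0 < a" using assms(1) by (simp add: mu_inflection_def)
  obtain z where z: "x < z" "z < p"
    and err: "mu_newton p x - p = (x - p) * (1 - deriv grotzsch_mu z / deriv grotzsch_mu x)"
    using mu_newton_error[of x p] assms a by auto
  have "deriv grotzsch_mu z < deriv grotzsch_mu x"
    using assms z by (intro deriv_mu_less_right_of_inflection[of a]) auto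
  then have "1 - deriv grotzsch_mu z / deriv grotzsch_mu x < 0"
    using deriv_mu_neg[of x] assms a by (simp add: less_divide_eq)
  then have "0 < (x - p) * (1 - deriv grotzsch_mu z / deriv grotzsch_mu x)"
    using assms by (intro mult_neg_neg) auto
  then show ?thesis using err by simp
qed

text \<open>Again the tangent lies above the graph, but from the right a step along it stops
  before \<open>p\<close>, and the quotient of the derivatives lies between zero and one.\<close>

lemma mu_newton_concave_right:
  assumes "mu_inflection a" "a \<le> p" "p < x" "x < 1"
  shows "p < mu_newton p x" "mu_newton p x < x"
proof -
  have a: "0 < a" using assms(1) by (simp add: mu_inflection_def)
  obtain z where z: "p < z" "z < x"
    and err: "mu_newton p x - p = (x - p) * (1 - deriv grotzsch_mu z / deriv grotzsch_mu x)"
    using mu_newton_error[of x p] assms a by auto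
  define q where "q = deriv grotzsch_mu z / deriv grotzsch_mu x"
  have "deriv grotzsch_mu x < deriv grotzsch_mu z"
    using assms z by (intro deriv_mu_less_right_of_inflection[of a]) auto
  then have "q < 1"
    unfolding q_def using deriv_mu_neg[of x] assms a by (simp add: divide_less_eq)
  moreover have "0 < q"
    unfolding q_def using deriv_mu_neg[of z] deriv_mu_neg[of x] assms a z
    by (intro divide_neg_neg) auto
  ultimately have "0 < (x - p) * (1 - q)" "(x - p) * (1 - q) < (x - p) * 1"
    using assms by (auto intro!: mult_strict_left_mono)
  then show "p < mu_newton p x" "mu_newton p x < x"
    using err unfolding q_def[symmetric] by simp_all
qed

section \<open>Orbits of the Newton map\<close>

lemma mu_newton_limit:
  assumes "X \<longlonglongrightarrow> L" "\<And>n. X (Suc n) = mu_newton p (X n)" "0 < L" "L < 1" "0 < p" "p < 1"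
  shows "L = p"
proof -
  have "grotzsch_mu L = grotzsch_mu p"
  proof (rule newton_limit_is_root[OF assms(1)])
    show "X (Suc n) = X n - (grotzsch_mu (X n) - grotzsch_mu p) / deriv grotzsch_mu (X n)" for n
      using assms(2) by (simp add: mu_newton_def)
    show "isCont grotzsch_mu L"
      using grotzsch_mu_has_derivative[OF assms(3,4)] by (rule DERIV_isCont)
    show "isCont (deriv grotzsch_mu) L"
      using deriv_grotzsch_mu_has_derivative[OF assms(3,4)] by (rule DERIV_isCont)
    show "deriv grotzsch_mu L \<noteq> 0" using deriv_mu_neg[OF assms(3,4)] by simp
  qed
  then show ?thesis
    using grotzsch_mu_strict_antimono[of L p] grotzsch_mu_strict_antimono[of p L] assms
    by (cases L p rule: linorder_cases) auto
qed

text \<open>Besides convergence this yields that an orbit cannot increase forever below a bound smaller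
  than the root, which is why an orbit must reach the region of concavity when the root lies there.\<close>

lemma mu_newton_increasing_limit:
  assumes "\<And>n. X (Suc n) = mu_newton p (X n)" "\<And>n. X n < X (Suc n)" "\<And>n. X n \<le> b"
    and "0 < X 0" "b < 1" "0 < p" "p < 1"
  shows "X \<longlonglongrightarrow> p" "p \<le> b"
proof -
  have inc: "incseq X" using assms(2) by (intro incseq_SucI less_imp_le)
  obtain L where L: "X \<longlonglongrightarrow> L" "\<And>n. X n \<le> L"
    using incseq_convergent[OF inc] assms(3) by metis
  have "L \<le> b" using L(1) assms(3) by (intro LIMSEQ_le_const2) auto
  moreover have "0 < L" using assms(4) L(2)[of 0] by simp
  ultimately have "L = p" using mu_newton_limit[OF L(1) assms(1)] assms by simp
  then show "X \<longlonglongrightarrow> p" "p \<le> b" using L \<open>L \<le> b\<close> by auto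
qed

lemma mu_newton_orbit_convex:
  assumes a: "mu_inflection a" and X: "\<And>n. X (Suc n) = mu_newton p (X n)"
    and "0 < X 0" "X 0 < p" "p \<le> a" "p \<le> 1 / sqrt 2"
  shows "0 < X n \<and> X n < p" "strict_mono X" "X \<longlonglongrightarrow> p"
proof -
  have in_range: "0 < X n \<and> X n < p" for n
  proof (induction n)
    case (Suc n)
    then show ?case
      using mu_newton_from_left(1)[of "X n" p] mu_newton_convex_left[OF a, of "X n" p] assms
      by auto
  qed (use assms in simp)
  then show "0 < X n \<and> X n < p" .
  have step: "X n < X (Suc n)" for n
    unfolding X using in_range[of n] assms by (intro mu_newton_from_left(1)) auto
  then show "strict_mono X" by (simp add: strict_mono_Suc_iff)
  show "X \<longlonglongrightarrow> p"
  proof (rule mu_newton_increasing_limit(1)[of X p p, OF X step])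
    show "X n \<le> p" for n using in_range[of n] by simp
    show "0 < p" using assms by linarith
    show "p < 1" using assms inv_sqrt2_less by linarith
  qed (use assms inv_sqrt2_less in linarith)+
qed

text \<open>Left of \<open>p\<close> the orbit increases, and right of \<open>p\<close> it decreases without ever returning, so it crosses at most
  once. It reaches \<open>[a, 1)\<close>, since it would otherwise increase to a limit below \<open>p\<close>. If it is there still
  left of \<open>p\<close>, the next step crosses. Without any crossing it must therefore have hit \<open>p\<close> exactly,
  and it stays there.\<close>

lemma mu_newton_orbit_concave:
  assumes a: "mu_inflection a" and X: "\<And>n. X (Suc n) = mu_newton p (X n)"
    and X0: "0 < X 0" "X 0 < p" and ap: "a < p" and p: "p \<le> 1 / sqrt 2"
  shows "0 < X n \<and> X n < 1"
    and "\<exists>N. a \<le> X N"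
    and "crosses_right X p m \<Longrightarrow> m < n \<Longrightarrow> p < X n"
    and "crosses_right X p m \<Longrightarrow> strict_antimono_on {m<..} X"
    and "(\<And>m. \<not> crosses_right X p m) \<Longrightarrow> \<exists>N. \<forall>n\<ge>N. X n = p"
    and "X \<longlonglongrightarrow> p"
proof -
  have p01: "0 < p" "p < 1" using X0 p inv_sqrt2_less by auto
  have a01: "0 < a" "a < 1" using a by (auto simp: mu_inflection_def)
  have fixed: "mu_newton p p = p" by (simp add: mu_newton_def)
  have right: "p < X (Suc n) \<and> X (Suc n) < X n" if "p < X n" "X n < 1" for n
    unfolding X using mu_newton_concave_right[OF a _ that] ap by simp
  have range: "0 < X n \<and> X n < 1" for n
  proof (induction n)
    case (Suc n)
    consider "X n < p" | "X n = p" | "p < X n" by linarith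
    then show ?case
    proof cases
      case 1
      then show ?thesis unfolding X using mu_newton_from_left[of "X n" p] Suc p by simp
    next
      case 2
      then show ?thesis unfolding X using fixed p01 by simp
    next
      case 3
      then show ?thesis using right[of n] Suc p01 by simp
    qed
  qed (use X0 p01 in simp)
  show "0 < X n \<and> X n < 1" by (rule range)
  have left: "X n < X (Suc n)" if "X n < p" for n
    unfolding X using mu_newton_from_left(1)[of "X n" p] range that p by simp
  have beyond: "p < X n" if "p < X k" "k \<le> n" for k n
    using that(2,1) by (induction rule: dec_induct) (use right range in auto)
  have decreasing: "X j < X i" if "p < X i" "i < j" for i j
  proof -
    have "Suc i \<le> j" using that by simp
    then show ?thesis
    proof (induction rule: dec_induct)
      case base
      then show ?case using right[OF that(1)] range by simp
    next
      case (step k)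
      have "p < X k" using beyond[OF that(1)] step by simp
      then show ?case using right[of k] range[of k] step by simp
    qed
  qed
  show reach: "\<exists>N. a \<le> X N"
  proof (rule ccontr)
    assume "\<nexists>N. a \<le> X N"
    then have below: "X n < a" for n by (meson not_le)
    have "p \<le> a"
      using below left ap X0 a01 p01
      by (intro mu_newton_increasing_limit(2)[of X p a, OF X]) (auto intro: less_imp_le less_trans)
    then show False using ap by simp
  qed
  show past: "p < X n" if "crosses_right X p m" "m < n" for m n
    using beyond[of "Suc m" n] that by (simp add: crosses_right_def)
  show anti: "strict_antimono_on {m<..} X" if "crosses_right X p m" for m
    using past[OF that] decreasing by (intro monotone_onI) auto
  have stays: "X n = p" if "X N = p" "N \<le> n" for N n
    using that(2,1) by (induction rule: dec_induct) (use fixed X in auto)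
  obtain N where N: "a \<le> X N" using reach by blast
  have lands: "X N = p" if no: "\<And>m. \<not> crosses_right X p m"
  proof -
    have le: "X n \<le> p" for n
    proof (induction n)
      case (Suc n)
      then show ?case using no[of n] by (simp add: crosses_right_def)
    qed (use X0 in simp)
    have "\<not> X N < p"
    proof
      assume "X N < p"
      then have "p < X (Suc N)" unfolding X using mu_newton_concave_left[OF a N] p01 by simp
      then show False using le[of "Suc N"] by simp
    qed
    then show ?thesis using le[of N] by simp
  qed
  show "\<exists>N. \<forall>n\<ge>N. X n = p" if "\<And>m. \<not> crosses_right X p m"
    using lands[OF that] stays by blast
  show "X \<longlonglongrightarrow> p"
  proof (cases "\<exists>m. crosses_right X p m")
    case False
    then have "\<forall>n\<ge>N. X n = p" using lands stays by blast
    then show ?thesis by (intro tendsto_eventually) (auto simp: eventually_sequentially)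
  next
    case True
    then obtain m where m: "crosses_right X p m" by blast
    define Y where "Y n = X (n + Suc m)" for n
    have Yp: "p < Y n" for n unfolding Y_def using past[OF m, of "n + Suc m"] by simp
    have Y1: "Y n < 1" for n unfolding Y_def using range by simp
    have "Y (Suc n) \<le> Y n" for n
      using right[of "n + Suc m"] Yp[of n] Y1[of n] by (simp add: Y_def)
    then have dec: "decseq Y" by (rule decseq_SucI)
    obtain L where L: "Y \<longlonglongrightarrow> L" "\<And>n. L \<le> Y n"
      using decseq_convergent[OF dec, of p] Yp by (metis less_imp_le)
    have "p \<le> L" using L(1) Yp by (intro LIMSEQ_le_const) (auto intro: less_imp_le)
    moreover have "L < 1" using L(2)[of 0] Y1[of 0] by simp
    ultimately have "L = p"
      using p01 by (intro mu_newton_limit[OF L(1), of p]) (auto simp: Y_def X)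
    then have "(\<lambda>n. X (n + Suc m)) \<longlonglongrightarrow> p" using L(1) by (simp add: Y_def[abs_def])
    then show ?thesis by (rule LIMSEQ_offset)
  qed
qed

text \<open>The value \<open>y\<close> lies between \<open>\<mu> (1 / \<surd>2) = \<pi>/2\<close> and \<open>\<mu> (1 / cosh y)\<close>, so the intermediate value theorem
  provides the preimage together with both bounds.\<close>

lemma grotzsch_mu_inv_bounds:
  assumes "pi / 2 < y"
  shows "grotzsch_mu (grotzsch_mu_inv y) = y" "1 / cosh y < grotzsch_mu_inv y"
    "grotzsch_mu_inv y < 1 / sqrt 2"
proof -
  have y: "0 < y" using assms pi_gt_zero by linarith
  have c: "0 < 1 / cosh y" using cosh_real_pos[of y] by simp
  have s: "1 / sqrt 2 < (1 :: real)" using inv_sqrt2_less by simp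
  have above: "y < grotzsch_mu (1 / cosh y)" using y by (rule grotzsch_mu_sech_greater)
  have c1: "1 / cosh y < 1" using y cosh_real_strict_mono[of 0 y] by simp
  have cs: "1 / cosh y < 1 / sqrt 2"
  proof (rule ccontr)
    assume "\<not> 1 / cosh y < 1 / sqrt 2"
    then have "grotzsch_mu (1 / cosh y) \<le> grotzsch_mu (1 / sqrt 2)"
      using grotzsch_mu_strict_antimono[of "1 / sqrt 2" "1 / cosh y"] c1
      by (cases "1 / sqrt 2 = 1 / cosh y") auto
    then show False using above assms by (simp add: grotzsch_mu_inv_sqrt2)
  qed
  have "\<exists>r\<ge>1 / cosh y. r \<le> 1 / sqrt 2 \<and> grotzsch_mu r = y"
  proof (rule IVT2)
    show "\<forall>r. 1 / cosh y \<le> r \<and> r \<le> 1 / sqrt 2 \<longrightarrow> isCont grotzsch_mu r"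
      using c s by (intro allI impI DERIV_isCont[OF grotzsch_mu_has_derivative]) linarith+
  qed (use above assms cs in \<open>auto simp: grotzsch_mu_inv_sqrt2\<close>)
  then obtain r where r: "1 / cosh y \<le> r" "r \<le> 1 / sqrt 2" "grotzsch_mu r = y" by blast
  have "inj_on grotzsch_mu {0<..<1}"
    by (rule linorder_inj_onI) (use grotzsch_mu_strict_antimono in force)+
  moreover have "r \<in> {0<..<1}" using r(1,2) c s by (simp only: greaterThanLessThan_iff) linarith
  ultimately have inv: "grotzsch_mu_inv y = r"
    unfolding grotzsch_mu_inv_def r(3)[symmetric] by (rule the_inv_into_f_f)
  have "r \<noteq> 1 / cosh y" "r \<noteq> 1 / sqrt 2"
    using r(3) above assms grotzsch_mu_inv_sqrt2 by auto
  then show "grotzsch_mu (grotzsch_mu_inv y) = y" "1 / cosh y < grotzsch_mu_inv y"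
    "grotzsch_mu_inv y < 1 / sqrt 2"
    using r by (auto simp: inv)
qed

section \<open>Convergence of Newton's iteration\<close>

theorem theorem4p1:
  fixes y \<rho> :: real and x :: "nat \<Rightarrow> real"
  assumes "y > pi / 2"
    and "\<rho> = grotzsch_mu_inv y"
    and "x 0 = 1 / cosh y"
    and "\<And>n. x (Suc n) = x n - (grotzsch_mu (x n) - y) / deriv grotzsch_mu (x n)"
  shows "(\<forall>n. 0 < x n \<and> x n < 1 \<and>
              grotzsch_mu differentiable at (x n) \<and> deriv grotzsch_mu (x n) \<noteq> 0) \<and>
         x \<longlonglongrightarrow> \<rho> \<and>
         (\<exists>!a. mu_inflection a) \<and>
         (\<forall>a. mu_inflection a \<longrightarrow>
            1 / 2 < a \<and> a < 1 / sqrt 2 \<and>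
            (\<rho> \<le> a \<longrightarrow> 0 < x 0 \<and> strict_mono x \<and> (\<forall>n. x n < \<rho>)) \<and>
            (\<rho> > a \<longrightarrow>
               (\<exists>N. a \<le> x N \<and> x N < 1) \<and>
               (\<forall>m n. crosses_right x \<rho> m \<and> crosses_right x \<rho> n \<longrightarrow> m = n) \<and>
               (\<forall>m. crosses_right x \<rho> m \<longrightarrow>
                  strict_antimono_on {m<..} x \<and> (\<forall>n>m. \<rho> < x n)) \<and>
               ((\<forall>m. \<not> crosses_right x \<rho> m) \<longrightarrow> (\<exists>N. \<forall>n\<ge>N. x n = \<rho>)))) \<and>
         (\<exists>C>0. \<exists>N. \<forall>n\<ge>N. \<bar>x (Suc n) - \<rho>\<bar> \<le> C * \<bar>x n - \<rho>\<bar>\<^sup>2)"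
proof -
  note y = assms(1) and inv = assms(2) and x0 = assms(3) and newton = assms(4)
  have mu_rho: "grotzsch_mu \<rho> = y" and x0_less: "x 0 < \<rho>" and rho_less: "\<rho> < 1 / sqrt 2"
    using grotzsch_mu_inv_bounds[OF y] by (simp_all add: inv x0)
  have x0_pos: "0 < x 0" using cosh_real_pos[of y] by (simp add: x0)
  have rho: "0 < \<rho>" "\<rho> < 1" using x0_pos x0_less rho_less inv_sqrt2_less by auto
  have step: "x (Suc n) = mu_newton \<rho> (x n)" for n
    using newton by (simp add: mu_newton_def mu_rho)
  obtain a where a: "mu_inflection a" "1 / 2 < a" "a < 1 / sqrt 2"
    by (rule mu_inflection_exists)
  have unique: "b = a" if "mu_inflection b" for b
    using mu_inflection_unique[OF that a(1)] .
  note convex = mu_newton_orbit_convex[OF a(1), of x \<rho>, OF step x0_pos x0_less _ less_imp_le[OF rho_less]]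
  note concave = mu_newton_orbit_concave[OF a(1), of x \<rho>, OF step x0_pos x0_less _ less_imp_le[OF rho_less]]
  have range: "0 < x n \<and> x n < 1" for n
    using convex(1)[of n] concave(1)[of n] rho by (cases "\<rho> \<le> a") auto
  have limit: "x \<longlonglongrightarrow> \<rho>"
    using convex(3) concave(6) by (cases "\<rho> \<le> a") auto
  have regular: "0 < x n \<and> x n < 1 \<and> grotzsch_mu differentiable at (x n) \<and> deriv grotzsch_mu (x n) \<noteq> 0"
    for n
    using range[of n] grotzsch_mu_has_derivative[of "x n"] deriv_mu_neg[of "x n"]
    by (auto simp: real_differentiable_def)
  have quadratic: "\<exists>C>0. \<exists>N. \<forall>n\<ge>N. \<bar>x (Suc n) - \<rho>\<bar> \<le> C * \<bar>x n - \<rho>\<bar>\<^sup>2"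
  proof (rule newton_eventually_quadratic[where S = "{0<..<1}"])
    show "x \<longlonglongrightarrow> \<rho>" by (rule limit)
    show "x (Suc n) = x n - (grotzsch_mu (x n) - grotzsch_mu \<rho>) / deriv grotzsch_mu (x n)" for n
      by (simp add: newton mu_rho)
    show "(grotzsch_mu has_real_derivative deriv grotzsch_mu z) (at z)" if "z \<in> {0<..<1}" for z
      using that grotzsch_mu_has_derivative[of z] deriv_grotzsch_mu[of z] by simp
    show "(deriv grotzsch_mu has_real_derivative mu_deriv2 z) (at z)" if "z \<in> {0<..<1}" for z
      using that deriv_grotzsch_mu_has_derivative[of z] by simp
    show "isCont mu_deriv2 \<rho>" using rho by (rule mu_deriv2_isCont)
    show "deriv grotzsch_mu \<rho> \<noteq> 0" using deriv_mu_neg[OF rho] by simp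
  qed (use rho in auto)
  have case_convex: "0 < x 0 \<and> strict_mono x \<and> (\<forall>n. x n < \<rho>)" if "\<rho> \<le> a"
    using convex(1,2)[OF that] x0_pos by blast
  have case_concave: "(\<exists>N. a \<le> x N \<and> x N < 1) \<and>
       (\<forall>m n. crosses_right x \<rho> m \<and> crosses_right x \<rho> n \<longrightarrow> m = n) \<and>
       (\<forall>m. crosses_right x \<rho> m \<longrightarrow>
          strict_antimono_on {m<..} x \<and> (\<forall>n>m. \<rho> < x n)) \<and>
       ((\<forall>m. \<not> crosses_right x \<rho> m) \<longrightarrow> (\<exists>N. \<forall>n\<ge>N. x n = \<rho>))" if "\<rho> > a"
  proof (intro conjI allI impI)
    show "\<exists>N. a \<le> x N \<and> x N < 1" using concave(2)[OF that] range by blast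
    have later: "\<not> m < n" if "crosses_right x \<rho> m" "crosses_right x \<rho> n" for m n
      using concave(3)[OF \<open>\<rho> > a\<close> that(1), of n] that(2) by (auto simp: crosses_right_def)
    show "m = n" if "crosses_right x \<rho> m \<and> crosses_right x \<rho> n" for m n
      using later[of m n] later[of n m] that by simp
    show "strict_antimono_on {m<..} x" if "crosses_right x \<rho> m" for m
      using concave(4)[OF \<open>\<rho> > a\<close> that] .
    show "\<rho> < x n" if "crosses_right x \<rho> m" "m < n" for m n
      using concave(3)[OF \<open>\<rho> > a\<close> that] .
    show "\<exists>N. \<forall>n\<ge>N. x n = \<rho>" if "\<forall>m. \<not> crosses_right x \<rho> m"
      using concave(5)[OF \<open>\<rho> > a\<close>] that by blast
  qed
  have alternatives: "1 / 2 < b \<and> b < 1 / sqrt 2 \<and>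
            (\<rho> \<le> b \<longrightarrow> 0 < x 0 \<and> strict_mono x \<and> (\<forall>n. x n < \<rho>)) \<and>
            (\<rho> > b \<longrightarrow>
               (\<exists>N. b \<le> x N \<and> x N < 1) \<and>
               (\<forall>m n. crosses_right x \<rho> m \<and> crosses_right x \<rho> n \<longrightarrow> m = n) \<and>
               (\<forall>m. crosses_right x \<rho> m \<longrightarrow>
                  strict_antimono_on {m<..} x \<and> (\<forall>n>m. \<rho> < x n)) \<and>
               ((\<forall>m. \<not> crosses_right x \<rho> m) \<longrightarrow> (\<exists>N. \<forall>n\<ge>N. x n = \<rho>)))"
    if "mu_inflection b" for b
    unfolding unique[OF that] by (intro conjI impI a(2,3) case_convex case_concave)
  have "\<exists>!b. mu_inflection b" using a(1) unique by (rule ex1I)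
  then show ?thesis
    using allI[OF regular] limit allI[OF impI[OF alternatives]] quadratic by (intro conjI)
qed

end
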